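(* Let $K$ be a number field, let $H:\mathcal{O}_K\to\mathcal{O}_K$ be a proper $\Lambda$-Hydra map with $p=|\mathcal{O}_K/\Lambda|$ and branches $H_j(z)=r_jz+c_j$ ($0\le j<p$), and let $\ell$ be a non-trivial place of $K$ with $\rho_{H,\ell}=\prod_{j=0}^{p-1}\|r_j\|_\ell<1$. Let $X_H:\mathbb{Z}_p\to K_\ell$ be the (almost everywhere defined, measurable) $\ell$-adic extension of the numen of $H$, and let $$\hat{\mu}_{H,\ell}(t)=\int_{\mathbb{Z}_p}e_\ell\left(-tX_H(\mathfrak{z})\right)d\mathfrak{z},\qquad t\in K_\ell,$$ be the $\ell$-adic characteristic function of $X_H$. Let $d\mu_{H,\ell}$ denote the continuous linear functional $W(K_\ell,\mathbb{C})\to\mathbb{C}$ defined by $$\int_{K_\ell}f(z)\,d\mu_{H,\ell}(z):=\int_{K_\ell}\hat{f}(t)\,\hat{\mu}_{H,\ell}(-t)\,dt,\qquad\forall f\in W(K_\ell,\mathbb{C}),$$ that is, $$\hat{\mu}_{H,\ell}(t)=\int_{K_\ell}e_\ell(-tz)\,d\mu_{H,\ell}(z).$$ Then $d\mu_{H,\ell}$ extends to a probability measure on $K_\ell$, and is the unique self-similar Borel probability measure on $K_\ell$ satisfying $$d\mu_{H,\ell}=\frac1p\sum_{j=0}^{p-1}H_{j,*}\{d\mu_{H,\ell}\}=\frac1p\sum_{j=0}^{p-1}d\mu_{H,\ell}\circ H_j^{-1},$$ i.e. $$\int_{K_\ell}f(z)\,d\mu_{H,\ell}(z)=\frac1p\sum_{j=0}^{p-1}\int_{K_\ell}f(H_j(z))\,d\mu_{H,\ell}(z).$$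 In particular, $$\int_{K_\ell}f(z)\,d\mu_{H,\ell}(z)=\int_{\mathbb{Z}_p}f\left(X_H(\mathfrak{z})\right)d\mathfrak{z},\qquad\forall f\in L^1(K_\ell,\mathbb{C}).$$
   Context: Places and norms. A place $\ell$ of the number field $K$ is an equivalence class of absolute values; fix a representative $|\cdot|_\ell$, and let $K_\ell$ be the completion. For a $\mathbb{Q}$-linear $r:K\to K$, $\|r\|_\ell:=\sup\{|rz|_\ell/|z|_\ell: z\in K,\ 0<|z|_\ell\le1\}$ is the $\ell$-adic operator norm of $r$; $r$ is extended to a map $K_\ell\to K_\ell$ with the same norm, also denoted $r$, and correspondingly each branch $H_j$ below is extended to a map $K_\ell\to K_\ell$, also denoted $H_j$. Hydra maps. Let $\Lambda\subset\mathcal{O}_K$ be a proper non-zero ideal of the ring of integers of $K$ and $p=|\mathcal{O}_K/\Lambda|$ (an integer $\ge2$, not necessarily prime). Fix an enumeration $\Lambda_0=\Lambda,\Lambda_1,\ldots,\Lambda_{p-1}$ of the cosets of $\Lambda$. A $\Lambda$-Hydra map is a map $H:\mathcal{O}_K\to\mathcal{O}_K$ given by $H(z)=r_jz+c_j$ for $z\in\Lambda_j$, where each $r_j:K\to K$ is an invertible $\mathbb{Q}$-linear map and $c_j\in K$. The maps $H_j(z)=r_jz+c_j$ are the branches of $H$. $H$ is proper if $1-r_0:K\to K$ is invertible. Numen. When $H$ is proper there is exactly one function $X_H:\mathbb{N}_0\to K$ with $X_H(pn+j)=r_jX_H(n)+c_j$ for all $n\in\mathbb{N}_0=\{0,1,2,\ldots\}$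 and $0\le j<p$; this is the numen of $H$. $\mathbb{Z}_p=\varprojlim_n\mathbb{Z}/p^n\mathbb{Z}$, with Haar probability measure $d\mathfrak{z}$ giving each $k+p^n\mathbb{Z}_p$ mass $p^{-n}$; $[\mathfrak{z}]_{p^n}$ is the integer in $\{0,\ldots,p^n-1\}$ congruent to $\mathfrak{z}$ mod $p^n$. When $\rho_{H,\ell}<1$, the limit $X_H(\mathfrak{z}):=\lim_{n\to\infty}X_H([\mathfrak{z}]_{p^n})$ exists in $K_\ell$ for almost every $\mathfrak{z}\in\mathbb{Z}_p$, defining a measurable function $X_H:\mathbb{Z}_p\to K_\ell$ (almost everywhere), which satisfies $X_H(p\mathfrak{z}+j)=H_j(X_H(\mathfrak{z}))$ wherever $X_H(\mathfrak{z})$ converges. Characters and Wiener algebra. Let $q$ be the place of $\mathbb{Q}$ under $\ell$ and $\mathbb{Q}_q$ the completion ($\mathbb{R}$ if $\ell$ is archimedean). $e_\ell(\mathfrak{x})=\exp\left(2\pi i\{\mathrm{Tr}_{K_\ell/\mathbb{Q}_q}(\mathfrak{x})\}_q\right)$ for $\mathfrak{x}\in K_\ell$, where $\{\cdot\}_q$ is the $q$-adic fractional part if $\ell$ is non-archimedean, and the identity map of $\mathbb{R}$ if $\ell$ is archimedean. $dw$, $dt$ denote Haar measure on $K_\ell$ (normalized to give the ring of integers $\mathcal{O}_{K_\ell}$ mass $1$ if $\ell$ is non-archimedean), and $L^1(K_\ell,\mathbb{C})$ is the space of complex-valued functions on $K_\ell$ that are absolutely integrable with respect to this Haar measure. $W(K_\ell,\mathbb{C})$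 is the Wiener algebra: all functions $\phi:K_\ell\to\mathbb{C}$ of the form $\phi(z)=\int_{K_\ell}\hat{\phi}(w)e_\ell(wz)\,dw$ for all $z\in K_\ell$, for some $\hat{\phi}\in L^1(K_\ell,\mathbb{C})$, with norm $\|\phi\|_{W(K_\ell,\mathbb{C})}=\int_{K_\ell}|\hat{\phi}(w)|\,dw$; in the claim, $\hat f$ denotes this $L^1$ function for $f\in W(K_\ell,\mathbb{C})$. $H_{j,*}\{d\mu\}=d\mu\circ H_j^{-1}$ denotes the pushforward of $d\mu$ under $H_j$. *)

theory Defs
  imports "HOL-Probability.Probability" "HOL-Algebra.QuotRing"
    "HOL-Computational_Algebra.Polynomial" "HOL-Computational_Algebra.Primes"
begin

section \<open>Number fields and their rings of integers\<close>

definition rat_scale :: "rat \<Rightarrow> 'k::field_char_0 \<Rightarrow> 'k" where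
  "rat_scale a x = of_rat a * x"

definition number_field :: "'k::field_char_0 itself \<Rightarrow> bool" where
  "number_field _ \<longleftrightarrow>
     (\<exists>B. finite_dimensional_vector_space (rat_scale :: rat \<Rightarrow> 'k \<Rightarrow> 'k) B)"

definition rat_linear :: "('k::field_char_0 \<Rightarrow> 'k) \<Rightarrow> bool" where
  "rat_linear f \<longleftrightarrow> Vector_Spaces.linear rat_scale rat_scale f"

definition ring_of_integers :: "'k::field_char_0 ring" where
  "ring_of_integers =
     \<lparr>carrier = {x. algebraic_int x}, mult = (*), one = 1, zero = 0, add = (+)\<rparr>"


section \<open>Places and completions\<close>

definition absolute_value :: "('a::field \<Rightarrow> real) \<Rightarrow> bool" where
  "absolute_value v \<longleftrightarrow>
     (\<forall>x. 0 \<le> v x) \<and> (\<forall>x. v x = 0 \<longleftrightarrow> x = 0) \<and>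
     (\<forall>x y. v (x * y) = v x * v y) \<and> (\<forall>x y. v (x + y) \<le> v x + v y)"

definition nontrivial_abs :: "('a::field \<Rightarrow> real) \<Rightarrow> bool" where
  "nontrivial_abs v \<longleftrightarrow> (\<exists>x. x \<noteq> 0 \<and> v x \<noteq> 1)"

definition nonarchimedean :: "('a::field \<Rightarrow> real) \<Rightarrow> bool" where
  "nonarchimedean v \<longleftrightarrow> (\<forall>x y. v (x + y) \<le> max (v x) (v y))"

text \<open>
  A completion depends on the place, so it cannot be a single type computed from \<open>'k\<close>. It is a
  type \<open>'l\<close> together with an embedding \<open>\<iota>\<close>, which determines it up to unique isometric
  isomorphism: a complete field whose metric comes from an absolute value \<open>v\<close>, containing \<open>'k\<close>
  isometrically as a dense subfield. Completeness is part of the sort \<open>polish_space\<close>. The second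
  countability in that sort is no restriction, because a number field is countable.
\<close>
definition completion_at ::
    "('k::field_char_0 \<Rightarrow> real) \<Rightarrow> ('k \<Rightarrow> 'l::{field_char_0,polish_space}) \<Rightarrow> ('l \<Rightarrow> real) \<Rightarrow> bool" where
  "completion_at w \<iota> v \<longleftrightarrow>
     absolute_value v \<and> (\<forall>x y. dist x y = v (x - y)) \<and>
     \<iota> 1 = 1 \<and> (\<forall>x y. \<iota> (x + y) = \<iota> x + \<iota> y) \<and> (\<forall>x y. \<iota> (x * y) = \<iota> x * \<iota> y) \<and>
     (\<forall>z. v (\<iota> z) = w z) \<and> closure (range \<iota>) = UNIV"

text \<open>Extended-real valued: a \<open>\<rat>\<close>-linear map need not be bounded for a given place.\<close>
definition op_norm :: "('k::field \<Rightarrow> real) \<Rightarrow> ('k \<Rightarrow> 'k) \<Rightarrow> ennreal" where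
  "op_norm w r = (SUP z\<in>{z. 0 < w z \<and> w z \<le> 1}. ennreal (w (r z) / w z))"

text \<open>The continuous extension to the completion of a map on \<open>'k\<close>.\<close>
definition extend_cont ::
    "('k \<Rightarrow> 'l::topological_space) \<Rightarrow> ('k \<Rightarrow> 'k) \<Rightarrow> 'l \<Rightarrow> 'l" where
  "extend_cont \<iota> f = (THE F. continuous_on UNIV F \<and> (\<forall>z. F (\<iota> z) = \<iota> (f z)))"


section \<open>The standard additive character of a completion\<close>

text \<open>
  Inside the completion \<open>'l\<close> of a number field, the completion of \<open>\<rat>\<close> at the place below is
  the closure of \<open>\<rat>\<close>.
\<close>
definition base_field :: "'l::{field_char_0,topological_space} set" where
  "base_field = closure (range of_rat)"

definition basis_over :: "'l::field set \<Rightarrow> 'l set \<Rightarrow> bool" where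
  "basis_over F B \<longleftrightarrow> finite B \<and> (\<forall>x. \<exists>!a. a \<in> B \<rightarrow>\<^sub>E F \<and> x = (\<Sum>b\<in>B. a b * b))"

definition coords :: "'l::field set \<Rightarrow> 'l set \<Rightarrow> 'l \<Rightarrow> 'l \<Rightarrow> 'l" where
  "coords F B x = (THE a. a \<in> B \<rightarrow>\<^sub>E F \<and> x = (\<Sum>b\<in>B. a b * b))"

text \<open>The trace of the \<open>F\<close>-linear map \<open>y \<mapsto> x * y\<close>, computed in some basis over the subfield \<open>F\<close>.\<close>
definition field_trace :: "'l::field set \<Rightarrow> 'l \<Rightarrow> 'l" where
  "field_trace F x = (let B = (SOME B. basis_over F B) in \<Sum>b\<in>B. coords F B (x * b) b)"

definition residue_prime :: "('l::field_char_0 \<Rightarrow> real) \<Rightarrow> nat" where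
  "residue_prime v = (THE q. prime q \<and> v (of_nat q) < 1)"

text \<open>
  The \<open>q\<close>-adic fractional part of an element of the base field, as the representative in
  \<open>\<int>[1/q] \<inter> [0, 1)\<close> modulo the \<open>q\<close>-adic integers.
\<close>
definition padic_frac :: "('l::field_char_0 \<Rightarrow> real) \<Rightarrow> 'l \<Rightarrow> rat" where
  "padic_frac v x = (THE y. 0 \<le> y \<and> y < 1 \<and> (\<exists>k. y * of_nat (residue_prime v) ^ k \<in> \<int>) \<and>
     v (x - of_rat y) \<le> 1)"

text \<open>
  For archimedean \<open>v\<close> the base field is a copy of \<open>\<real>\<close>; this is the identification, which is
  the identity on rationals. The metric on \<open>'l\<close> may be a power of the usual one, depending on the
  absolute value chosen to represent the place, but has the same convergent sequences of rationals.
\<close>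
definition to_real :: "'l::{field_char_0,topological_space} \<Rightarrow> real" where
  "to_real x = (THE a. \<exists>s :: nat \<Rightarrow> rat.
     (\<lambda>n. of_rat (s n)) \<longlonglongrightarrow> x \<and> (\<lambda>n. of_rat (s n)) \<longlonglongrightarrow> a)"

definition frac_part :: "('l::{field_char_0,topological_space} \<Rightarrow> real) \<Rightarrow> 'l \<Rightarrow> real" where
  "frac_part v x = (if nonarchimedean v then of_rat (padic_frac v x) else to_real x)"

definition add_char :: "('l::{field_char_0,topological_space} \<Rightarrow> real) \<Rightarrow> 'l \<Rightarrow> complex" where
  "add_char v x = exp (2 * of_real pi * \<i> * of_real (frac_part v (field_trace base_field x)))"


section \<open>Haar measure and the Wiener algebra of a completion\<close>

text \<open>
  Local finiteness is equivalent to finiteness on compact sets, and regularity is automatic, as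
  completions of number fields at nontrivial places are locally compact and second countable. For
  archimedean \<open>v\<close> no normalization is imposed: rescaling \<open>M\<close> divides \<open>wiener_hat\<close> below by
  the same factor and does not affect \<open>wiener_norm\<close> and \<open>wiener_functional\<close>.
\<close>
definition haar_measure :: "('l::{field,topological_space} \<Rightarrow> real) \<Rightarrow> 'l measure \<Rightarrow> bool" where
  "haar_measure v M \<longleftrightarrow>
     sets M = sets borel \<and> emeasure M UNIV \<noteq> 0 \<and>
     (\<forall>x. \<exists>U. open U \<and> x \<in> U \<and> emeasure M U < \<infinity>) \<and>
     (\<forall>a. \<forall>A\<in>sets borel. emeasure M ((+) a ` A) = emeasure M A) \<and>
     (nonarchimedean v \<longrightarrow> emeasure M {x. v x \<le> 1} = 1)"

text \<open>In the following, \<open>e\<close> is the additive character and \<open>M\<close> the Haar measure.\<close>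

definition represents :: "('l::field \<Rightarrow> complex) \<Rightarrow> 'l measure \<Rightarrow> ('l \<Rightarrow> complex) \<Rightarrow> ('l \<Rightarrow> complex) \<Rightarrow> bool" where
  "represents e M g f \<longleftrightarrow> integrable M g \<and> (\<forall>z. f z = (LINT w|M. g w * e (w * z)))"

definition wiener_algebra :: "('l::field \<Rightarrow> complex) \<Rightarrow> 'l measure \<Rightarrow> ('l \<Rightarrow> complex) set" where
  "wiener_algebra e M = {f. \<exists>g. represents e M g f}"

text \<open>The representing function is unique up to null sets.\<close>
definition wiener_hat :: "('l::field \<Rightarrow> complex) \<Rightarrow> 'l measure \<Rightarrow> ('l \<Rightarrow> complex) \<Rightarrow> 'l \<Rightarrow> complex" where
  "wiener_hat e M f = (SOME g. represents e M g f)"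

definition wiener_norm :: "('l::field \<Rightarrow> complex) \<Rightarrow> 'l measure \<Rightarrow> ('l \<Rightarrow> complex) \<Rightarrow> real" where
  "wiener_norm e M f = (LINT w|M. cmod (wiener_hat e M f w))"

text \<open>The functional \<open>f \<mapsto> \<integral> f d\<mu>\<close> on the Wiener algebra with characteristic function \<open>\<phi>\<close>.\<close>
definition wiener_functional ::
    "('l::field \<Rightarrow> complex) \<Rightarrow> 'l measure \<Rightarrow> ('l \<Rightarrow> complex) \<Rightarrow> ('l \<Rightarrow> complex) \<Rightarrow> complex" where
  "wiener_functional e M \<phi> f = (LINT t|M. wiener_hat e M f t * \<phi> (- t))"

definition continuous_linear_on_wiener ::
    "('l::field \<Rightarrow> complex) \<Rightarrow> 'l measure \<Rightarrow> (('l \<Rightarrow> complex) \<Rightarrow> complex) \<Rightarrow> bool" where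
  "continuous_linear_on_wiener e M T \<longleftrightarrow>
     (\<forall>f\<in>wiener_algebra e M. \<forall>g\<in>wiener_algebra e M. \<forall>a b.
        T (\<lambda>z. a * f z + b * g z) = a * T f + b * T g) \<and>
     (\<exists>C. \<forall>f\<in>wiener_algebra e M. cmod (T f) \<le> C * wiener_norm e M f)"


section \<open>The \<open>p\<close>-adic integers for \<open>p \<ge> 2\<close> not necessarily prime\<close>

text \<open>
  The inverse limit of the rings \<open>\<int>/p\<^sup>n\<int>\<close>, an element \<open>z\<close> being its sequence of residues:
  \<open>z n\<close> is the representative in \<open>{0..<p\<^sup>n}\<close> of \<open>z\<close> modulo \<open>p\<^sup>n\<close>.
\<close>
definition padic_ints :: "nat \<Rightarrow> (nat \<Rightarrow> nat) set" where
  "padic_ints p = {z. \<forall>n. z n < p ^ n \<and> z (Suc n) mod p ^ n = z n}"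

text \<open>The coset of \<open>k\<close> modulo \<open>p\<^sup>n\<close>.\<close>
definition padic_coset :: "nat \<Rightarrow> nat \<Rightarrow> nat \<Rightarrow> (nat \<Rightarrow> nat) set" where
  "padic_coset p n k = {z \<in> padic_ints p. z n = k mod p ^ n}"

definition padic_cosets :: "nat \<Rightarrow> (nat \<Rightarrow> nat) set set" where
  "padic_cosets p = {padic_coset p n k | n k. True}"

definition padic_of_digits :: "nat \<Rightarrow> (nat \<Rightarrow> nat) \<Rightarrow> nat \<Rightarrow> nat" where
  "padic_of_digits p d n = (\<Sum>i<n. d i * p ^ i)"

text \<open>
  Haar probability measure, constructed by choosing the digits independently and uniformly; its
  characteristic property is \<open>emeasure_padic_haar_coset\<close> below.
\<close>
definition padic_haar :: "nat \<Rightarrow> (nat \<Rightarrow> nat) measure" where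
  "padic_haar p =
     distr (PiM UNIV (\<lambda>_. uniform_count_measure {..<p}))
           (sigma (padic_ints p) (padic_cosets p)) (padic_of_digits p)"


section \<open>Hydra maps and the numen\<close>

text \<open>\<open>L j\<close> for \<open>j < p\<close> enumerates the cosets of the ideal \<open>\<Lambda>\<close>, starting with \<open>\<Lambda>\<close> itself.\<close>
definition hydra_map ::
    "'k::field_char_0 set \<Rightarrow> nat \<Rightarrow> (nat \<Rightarrow> 'k set) \<Rightarrow> (nat \<Rightarrow> 'k \<Rightarrow> 'k) \<Rightarrow> (nat \<Rightarrow> 'k) \<Rightarrow>
     ('k \<Rightarrow> 'k) \<Rightarrow> bool" where
  "hydra_map \<Lambda> p L r c H \<longleftrightarrow>
     ideal \<Lambda> ring_of_integers \<and> \<Lambda> \<noteq> {0} \<and> \<Lambda> \<noteq> carrier ring_of_integers \<and>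
     p = card (carrier (ring_of_integers Quot \<Lambda>)) \<and>
     bij_betw L {..<p} (carrier (ring_of_integers Quot \<Lambda>)) \<and> L 0 = \<Lambda> \<and>
     (\<forall>j<p. rat_linear (r j) \<and> bij (r j)) \<and>
     H \<in> carrier ring_of_integers \<rightarrow> carrier ring_of_integers \<and>
     (\<forall>j<p. \<forall>z\<in>L j. H z = r j z + c j)"

definition proper_hydra :: "(nat \<Rightarrow> 'k::field_char_0 \<Rightarrow> 'k) \<Rightarrow> bool" where
  "proper_hydra r \<longleftrightarrow> bij (\<lambda>z. z - r 0 z)"

definition numen :: "nat \<Rightarrow> (nat \<Rightarrow> 'k::field_char_0 \<Rightarrow> 'k) \<Rightarrow> (nat \<Rightarrow> 'k) \<Rightarrow> nat \<Rightarrow> 'k" where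
  "numen p r c = (THE X. \<forall>n. \<forall>j<p. X (p * n + j) = r j (X n) + c j)"

text \<open>The extension to the \<open>p\<close>-adic integers; of no significance where the limit does not exist.\<close>
definition numen_ext ::
    "nat \<Rightarrow> ('k::field_char_0 \<Rightarrow> 'l::t2_space) \<Rightarrow> (nat \<Rightarrow> 'k \<Rightarrow> 'k) \<Rightarrow> (nat \<Rightarrow> 'k) \<Rightarrow>
     (nat \<Rightarrow> nat) \<Rightarrow> 'l" where
  "numen_ext p \<iota> r c z = lim (\<lambda>n. \<iota> (numen p r c (z n)))"

definition branch_ext ::
    "('k::field_char_0 \<Rightarrow> 'l::t2_space) \<Rightarrow> (nat \<Rightarrow> 'k \<Rightarrow> 'k) \<Rightarrow> (nat \<Rightarrow> 'k) \<Rightarrow> nat \<Rightarrow> 'l \<Rightarrow> 'l" where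
  "branch_ext \<iota> r c j = extend_cont \<iota> (\<lambda>z. r j z + c j)"

definition hydra_rho :: "('k::field \<Rightarrow> real) \<Rightarrow> nat \<Rightarrow> (nat \<Rightarrow> 'k \<Rightarrow> 'k) \<Rightarrow> ennreal" where
  "hydra_rho w p r = (\<Prod>j<p. op_norm w (r j))"

text \<open>The characteristic function of a random variable \<open>X\<close> on the \<open>p\<close>-adic integers.\<close>
definition char_fun ::
    "nat \<Rightarrow> ('l::field \<Rightarrow> complex) \<Rightarrow> ((nat \<Rightarrow> nat) \<Rightarrow> 'l) \<Rightarrow> 'l \<Rightarrow> complex" where
  "char_fun p e X t = (LINT z|padic_haar p. e (- (t * X z)))"


section \<open>Self-similar measures\<close>

definition borel_prob :: "'l::topological_space measure \<Rightarrow> bool" where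
  "borel_prob \<mu> \<longleftrightarrow> prob_space \<mu> \<and> sets \<mu> = sets borel"

definition self_similar :: "nat \<Rightarrow> (nat \<Rightarrow> 'l::topological_space \<Rightarrow> 'l) \<Rightarrow> 'l measure \<Rightarrow> bool" where
  "self_similar p h \<mu> \<longleftrightarrow>
     (\<forall>A\<in>sets borel. emeasure \<mu> A = (\<Sum>j<p. emeasure (distr \<mu> borel (h j)) A) / of_nat p)"


section \<open>Sanity checks for the measure on the \<open>p\<close>-adic integers\<close>

lemma padic_of_digits_less:
  assumes "\<And>i. d i < p" shows "padic_of_digits p d n < p ^ n"
proof (induction n)
  case 0
  then show ?case by (simp add: padic_of_digits_def)
next
  case (Suc n)
  have "padic_of_digits p d (Suc n) = padic_of_digits p d n + d n * p ^ n"
    by (simp add: padic_of_digits_def)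
  also have "\<dots> < p ^ n + d n * p ^ n" using Suc by simp
  also have "\<dots> = Suc (d n) * p ^ n" by simp
  also have "\<dots> \<le> p * p ^ n" using assms[of n] by (intro mult_right_mono) auto
  finally show ?case by simp
qed

lemma padic_of_digits_in:
  assumes "\<And>i. d i < p" shows "padic_of_digits p d \<in> padic_ints p"
  using padic_of_digits_less[OF assms]
  by (auto simp: padic_ints_def padic_of_digits_def)

lemma padic_of_digits_eq_iff:
  assumes "\<And>i. d i < p" "\<And>i. d' i < p"
  shows "padic_of_digits p d n = padic_of_digits p d' n \<longleftrightarrow> (\<forall>i<n. d i = d' i)"
proof (induction n)
  case 0
  then show ?case by (simp add: padic_of_digits_def)
next
  case (Suc n)
  have S: "padic_of_digits p f (Suc n) = padic_of_digits p f n + f n * p ^ n" for f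
    by (simp add: padic_of_digits_def)
  have l: "padic_of_digits p d n < p ^ n" "padic_of_digits p d' n < p ^ n"
    using padic_of_digits_less assms by blast+
  have p: "p ^ n > 0" using l(1) by linarith
  have modd: "(a + b * p ^ n) mod p ^ n = a" if "a < p ^ n" for a b
    using that by simp
  have "padic_of_digits p d (Suc n) = padic_of_digits p d' (Suc n) \<longleftrightarrow>
      padic_of_digits p d n = padic_of_digits p d' n \<and> d n = d' n"
  proof
    assume eq: "padic_of_digits p d (Suc n) = padic_of_digits p d' (Suc n)"
    then have "padic_of_digits p d n = padic_of_digits p d' n"
      using modd[OF l(1), of "d n"] modd[OF l(2), of "d' n"] by (simp add: S)
    moreover from this eq have "d n * p ^ n = d' n * p ^ n" by (simp only: S add_left_cancel)
    ultimately show "padic_of_digits p d n = padic_of_digits p d' n \<and> d n = d' n"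
      using p by (metis less_numeral_extra(3) mult_cancel2)
  qed (simp add: S)
  with Suc show ?case by (auto simp: less_Suc_eq)
qed

lemma padic_digits_exist:
  assumes "k < p ^ n" "p > 0"
  obtains d where "\<And>i. d i < p" "padic_of_digits p d n = k"
proof -
  have "\<exists>d. (\<forall>i. d i < p) \<and> padic_of_digits p d n = k"
    using assms(1)
  proof (induction n arbitrary: k)
    case 0
    then show ?case using assms(2) by (auto simp: padic_of_digits_def intro!: exI[of _ "\<lambda>_. 0"])
  next
    case (Suc n)
    have "k mod p ^ n < p ^ n" using assms(2) by simp
    then obtain d where d: "\<forall>i. d i < p" "padic_of_digits p d n = k mod p ^ n"
      using Suc.IH by blast
    have "k div p ^ n < p"
      using Suc.prems by (simp add: less_mult_imp_div_less)
    moreover have "padic_of_digits p (d(n := k div p ^ n)) (Suc n) = k"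
    proof -
      have "padic_of_digits p (d(n := k div p ^ n)) n = padic_of_digits p d n"
        unfolding padic_of_digits_def by (intro sum.cong) auto
      then have "padic_of_digits p (d(n := k div p ^ n)) (Suc n) = k mod p ^ n + k div p ^ n * p ^ n"
        using d(2) by (simp add: padic_of_digits_def)
      then show ?thesis by (simp only: mod_div_mult_eq)
    qed
    moreover have "(d(n := k div p ^ n)) i < p" if "k div p ^ n < p" for i
      using that d(1) by simp
    ultimately show ?case by blast
  qed
  then show ?thesis using that by blast
qed

lemma padic_cosets_subset: "padic_cosets p \<subseteq> Pow (padic_ints p)"
  by (auto simp: padic_cosets_def padic_coset_def)

lemma measurable_padic_of_digits:
  assumes "p > 0"
  shows "padic_of_digits p \<in> measurable (PiM UNIV (\<lambda>_. uniform_count_measure {..<p}))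
           (sigma (padic_ints p) (padic_cosets p))"
    and "padic_of_digits p -` padic_coset p n k \<inter>
           space (PiM UNIV (\<lambda>_. uniform_count_measure {..<p})) =
         {x \<in> space (PiM UNIV (\<lambda>_. uniform_count_measure {..<p})).
            padic_of_digits p x n = k mod p ^ n}"
proof -
  let ?P = "PiM UNIV (\<lambda>_::nat. uniform_count_measure {..<p})"
  have sp: "x \<in> space ?P \<Longrightarrow> x i < p" for x i
    by (auto simp: space_PiM space_uniform_count_measure)
  have inP: "padic_of_digits p x \<in> padic_ints p" if "x \<in> space ?P" for x
    using sp[OF that] by (rule padic_of_digits_in)
  show vi: "padic_of_digits p -` padic_coset p n k \<inter> space ?P =
         {x \<in> space ?P. padic_of_digits p x n = k mod p ^ n}" for n k
    using inP by (auto simp: padic_coset_def)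
  have comp: "(\<lambda>x. x i) \<in> measurable ?P (count_space UNIV)" for i
  proof -
    have "(\<lambda>x. x i) \<in> measurable ?P (uniform_count_measure {..<p})"
      by (rule measurable_component_singleton) simp
    also have "\<dots> = measurable ?P (count_space {..<p})"
      by (rule measurable_cong_sets) (simp_all add: sets_uniform_count_measure)
    finally show ?thesis
      by (rule measurable_compose) simp
  qed
  have [measurable]: "(\<lambda>x. padic_of_digits p x n) \<in> measurable ?P (count_space UNIV)" for n
  proof (induction n)
    case 0
    then show ?case by (simp add: padic_of_digits_def)
  next
    case (Suc n)
    let ?C = "count_space (UNIV :: nat set)"
    have "(\<lambda>x. (padic_of_digits p x n, x n)) \<in> measurable ?P (?C \<Otimes>\<^sub>M ?C)"
      by (intro measurable_Pair Suc comp)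
    moreover have "(\<lambda>(a, b). a + b * p ^ n) \<in> measurable (?C \<Otimes>\<^sub>M ?C) ?C"
      by (simp add: pair_measure_countable)
    ultimately have "(\<lambda>x. case (padic_of_digits p x n, x n) of (a, b) \<Rightarrow> a + b * p ^ n)
        \<in> measurable ?P ?C"
      by (rule measurable_compose)
    then show ?case by (simp add: padic_of_digits_def)
  qed
  show "padic_of_digits p \<in> measurable ?P (sigma (padic_ints p) (padic_cosets p))"
  proof (rule measurable_measure_of[OF padic_cosets_subset])
    show "padic_of_digits p \<in> space ?P \<rightarrow> padic_ints p"
      using inP by blast
    fix A assume "A \<in> padic_cosets p"
    then obtain n k where A: "A = padic_coset p n k" by (auto simp: padic_cosets_def)
    show "padic_of_digits p -` A \<inter> space ?P \<in> sets ?P"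
      unfolding A vi by measurable
  qed
qed

lemma emeasure_padic_haar_coset:
  assumes "p > 0"
  shows "emeasure (padic_haar p) (padic_coset p n k) = ennreal (1 / real p ^ n)"
proof -
  let ?U = "uniform_count_measure {..<p}"
  let ?P = "PiM UNIV (\<lambda>_::nat. ?U)"
  have pU: "prob_space ?U" using assms by (intro prob_space_uniform_count_measure) auto
  interpret product_prob_space "\<lambda>_::nat. ?U" UNIV
    by (intro product_prob_spaceI pU)
  have sp: "x \<in> space ?P \<Longrightarrow> x i < p" for x i
    by (auto simp: space_PiM space_uniform_count_measure)
  obtain d where d: "\<And>i. d i < p" "padic_of_digits p d n = k mod p ^ n"
    using padic_digits_exist[of "k mod p ^ n" p n] assms by auto
  have "padic_coset p n k \<in> sets (sigma (padic_ints p) (padic_cosets p))"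
    using padic_cosets_subset by (auto simp: sets_measure_of padic_cosets_def)
  then have "emeasure (padic_haar p) (padic_coset p n k) =
      emeasure ?P {x \<in> space ?P. padic_of_digits p x n = k mod p ^ n}"
    unfolding padic_haar_def
    by (subst emeasure_distr[OF measurable_padic_of_digits(1)[OF assms]])
       (simp_all only: measurable_padic_of_digits(2)[OF assms])
  also have "{x \<in> space ?P. padic_of_digits p x n = k mod p ^ n} =
      {x \<in> space ?P. \<forall>i\<in>{..<n}. x i \<in> {d i}}"
  proof -
    have "padic_of_digits p x n = k mod p ^ n \<longleftrightarrow> (\<forall>i<n. x i = d i)" if "x \<in> space ?P" for x
      using padic_of_digits_eq_iff[of x p d n] sp[OF that] d by simp
    then show ?thesis by auto
  qed
  also have "emeasure ?P \<dots> = (\<Prod>i\<in>{..<n}. emeasure ?U {d i})"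
    using d(1) by (intro emeasure_PiM_Collect) (auto simp: sets_uniform_count_measure)
  also have "\<dots> = (\<Prod>i\<in>{..<n}. ennreal (1 / real p))"
    using d(1) by (intro prod.cong refl) (subst emeasure_uniform_count_measure, auto)
  also have "\<dots> = ennreal (1 / real p ^ n)"
    by (simp add: ennreal_power power_one_over)
  finally show ?thesis .
qed

end

theory Submission
  imports Defs "HOL-Real_Asymp.Real_Asymp"
begin

text \<open>
  In terms of the digits of \<open>z\<close>, the value \<open>X(z)\<close> is the limit of
  \<open>H\<^bsub>d 0\<^esub> \<circ> \<dots> \<circ> H\<^bsub>d (n-1)\<^esub>\<close> at an arbitrary point. The digits are independent and
  uniform, and \<open>\<rho> < 1\<close> makes the expectation of \<open>(\<Prod>\<^sub>i \<parallel>r\<^bsub>d i\<^esub>\<parallel>)\<^sup>s\<close> decay geometrically for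
  small \<open>s > 0\<close>, so the limit exists almost surely and forgets its starting point. Its law \<open>\<mu>\<close> is
  self-similar because splitting off the first digit preserves Haar measure; any self-similar
  probability measure is the law of the same compositions at a random point, and hence equals \<open>\<mu>\<close>.
  The functional is integration against \<open>\<mu>\<close> by Fubini's theorem. This needs the additive
  character to be measurable; it is continuous because the completion is finite-dimensional over
  the closure of the rationals.
\<close>

section \<open>Fields with an absolute value\<close>

text \<open>Since \<open>lim\<close> takes one fixed value wherever it diverges, \<open>X\<close> is
  defined and measurable everywhere, and its law can be formed without removing a null set. For
  uniqueness, Fatou's lemma yields only \<mu>(W) \<le> \<nu>(W) for open W; outer regularity extends
  this to Borel sets, and equal total mass turns it into equality. The character is where the kind
  of place matters. At a nonarchimedean place the fractional part is locally constant. At an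
  archimedean place it identifies the closure of the rationals with the reals through rational
  sequences only, while the absolute value may be a proper power of the usual one. Hence a fragment
  of Ostrowski's theorem: an absolute value that is not nonarchimedean is monotone on the natural
  numbers, so rationals that are small for it are small real numbers. The condition \<rho> < 1
  concerns extended reals, where 0 * \<infinity> = 0. Injectivity of each \<open>r j\<close> keeps
  the factors positive; then all are finite and the branches are Lipschitz.\<close>

locale valued_field =
  fixes v :: "'a::field \<Rightarrow> real"
  assumes absolute_value: "absolute_value v"
begin

lemma nonneg [simp]: "0 \<le> v x"
  and eq_0_iff [simp]: "v x = 0 \<longleftrightarrow> x = 0"
  and mult: "v (x * y) = v x * v y"
  and triangle: "v (x + y) \<le> v x + v y"
  using absolute_value by (auto simp: absolute_value_def)

lemma zero [simp]: "v 0 = 0"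
  using eq_0_iff by blast

lemma one [simp]: "v 1 = 1"
  using mult[of 1 1] by simp

lemma minus [simp]: "v (- x) = v x"
proof -
  have "v (- 1) * v (- 1) = 1"
    using mult[of "- 1" "- 1"] by simp
  then have "v (- 1) = 1"
    by (metis nonneg abs_of_nonneg abs_mult_self_eq real_sqrt_abs2 real_sqrt_one)
  then show ?thesis
    using mult[of "- 1" x] by simp
qed

lemma pos_iff: "0 < v x \<longleftrightarrow> x \<noteq> 0"
  using nonneg[of x] by (simp add: less_le)

lemma minus_commute: "v (x - y) = v (y - x)"
  using minus[of "x - y"] by simp

lemma power: "v (x ^ n) = v x ^ n"
  by (induction n) (simp_all add: mult)

lemma inverse: "v (inverse x) = inverse (v x)"
proof (cases "x = 0")
  case False
  then have "v x * v (inverse x) = 1"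
    by (simp flip: mult)
  then show ?thesis
    by (simp add: inverse_unique)
qed simp

lemma divide: "v (x / y) = v x / v y"
  by (simp add: divide_inverse mult inverse)

lemma sum_le: "v (sum f A) \<le> (\<Sum>x\<in>A. v (f x))"
  by (induction A rule: infinite_finite_induct)
    (auto intro: order_trans[OF triangle])

text \<open>The binomial expansion of \<open>(x + y) ^ n\<close> has \<open>n + 1\<close> terms of
  value at most \<open>m ^ n\<close> with \<open>m = max (v x) (v y)\<close>; an exponential with
  base above 1 outgrows the factor \<open>n + 1\<close>.\<close>

lemma nonarchimedean_of_nat_le_1:
  assumes "\<And>n. v (of_nat n) \<le> 1"
  shows "nonarchimedean v"
  unfolding nonarchimedean_def
proof safe
  fix x y
  define m where "m = max (v x) (v y)"
  have m0: "0 \<le> m" by (simp add: m_def le_max_iff_disj)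
  have le: "v (x + y) ^ n \<le> real (n + 1) * m ^ n" for n
  proof -
    have "v (x + y) ^ n = v (\<Sum>k\<le>n. of_nat (n choose k) * x ^ k * y ^ (n - k))"
      by (simp add: power[symmetric] binomial_ring)
    also have "\<dots> \<le> (\<Sum>k\<le>n. v (of_nat (n choose k) * x ^ k * y ^ (n - k)))"
      by (rule sum_le)
    also have "\<dots> \<le> (\<Sum>k\<le>n. m ^ n)"
    proof (rule sum_mono)
      fix k assume k: "k \<in> {..n}"
      have "v (of_nat (n choose k) * x ^ k * y ^ (n - k))
          = v (of_nat (n choose k)) * (v x ^ k * v y ^ (n - k))"
        by (simp add: mult power)
      also have "\<dots> \<le> 1 * (m ^ k * m ^ (n - k))"
        using m0 by (intro mult_mono assms power_mono) (auto simp: m_def)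
      also have "\<dots> = m ^ n"
        using k by (simp flip: power_add)
      finally show "v (of_nat (n choose k) * x ^ k * y ^ (n - k)) \<le> m ^ n" .
    qed
    finally show ?thesis by simp
  qed
  show "v (x + y) \<le> max (v x) (v y)"
  proof (rule ccontr)
    assume "\<not> ?thesis"
    then have gt: "m < v (x + y)" unfolding m_def by (rule not_le_imp_less)
    have "m > 0"
    proof (rule ccontr)
      assume "\<not> m > 0"
      then have "m = 0" using m0 by simp
      then show False
        using le[of 1] gt by simp
    qed
    define t where "t = v (x + y) / m"
    have t: "t > 1" using gt \<open>m > 0\<close> by (simp add: t_def)
    have le': "t ^ n \<le> real (n + 1)" for n
      using le[of n] \<open>m > 0\<close> by (simp add: t_def power_divide field_simps)
    have "eventually (\<lambda>n. t ^ n > real (n + 1)) sequentially"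
      using t by real_asymp
    from eventually_happens'[OF sequentially_bot this]
    obtain n where "t ^ n > real (n + 1)" by blast
    with le'[of n] show False by simp
  qed
qed

text \<open>Expansion of \<open>n\<close> in base \<open>a\<close>.\<close>
lemma of_nat_le_digits:
  fixes a :: nat
  assumes "2 \<le> a" "n < a ^ m" "\<And>d. d < a \<Longrightarrow> v (of_nat d) \<le> D"
  shows "v (of_nat n) \<le> real m * D * max 1 (v (of_nat a)) ^ m"
  using assms(2)
proof (induction m arbitrary: n)
  case (Suc m)
  define A where "A = max 1 (v (of_nat a))"
  have A: "1 \<le> A" "v (of_nat a) \<le> A" "0 \<le> A" by (auto simp: A_def)
  have D: "0 \<le> D" using assms(1) assms(3)[of 0] by simp
  have "n div a < a ^ m"
    using Suc.prems by (simp add: less_mult_imp_div_less mult.commute)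
  then have IH: "v (of_nat (n div a)) \<le> real m * D * A ^ m"
    using Suc.IH unfolding A_def by blast
  have "v (of_nat n) = v (of_nat (n mod a) + of_nat a * of_nat (n div a))"
    by (metis mod_mult_div_eq of_nat_add of_nat_mult)
  also have "\<dots> \<le> v (of_nat (n mod a)) + v (of_nat a) * v (of_nat (n div a))"
    using triangle by (simp flip: mult)
  also have "\<dots> \<le> D + A * (real m * D * A ^ m)"
    using assms(1) A D by (intro add_mono mult_mono assms(3) IH) auto
  also have "\<dots> \<le> D * A ^ Suc m + A * (real m * D * A ^ m)"
    using mult_left_mono[OF one_le_power[OF A(1), of "Suc m"] D] by simp
  also have "\<dots> = real (Suc m) * D * A ^ Suc m"
    by (simp add: algebra_simps)
  finally show ?case by (simp add: A_def)
qed simp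

text \<open>
  The powers \<open>b\<^sup>k\<close> have at most \<open>c * k\<close> digits in base \<open>a\<close>; the polynomial factors disappear
  when taking \<open>k\<close>-th roots.
\<close>
lemma of_nat_le_power:
  fixes a b :: nat
  assumes a: "2 \<le> a" and b: "b < a ^ c"
  shows "v (of_nat b) \<le> max 1 (v (of_nat a)) ^ c"
proof (rule ccontr)
  define A where "A = max 1 (v (of_nat a))"
  define D where "D = (\<Sum>d<a. v (of_nat d))"
  define t where "t = v (of_nat b) / A ^ c"
  \<comment> \<open>The maximum with 1 covers \<open>c = 0\<close> and keeps \<open>C\<close>
    positive in the comparison of growth rates.\<close>
  define C where "C = max 1 (real c * D)"
  have A: "1 \<le> A" by (auto simp: A_def)
  assume "\<not> ?thesis"
  then have t: "t > 1" using A by (simp add: t_def A_def field_simps)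
  have D: "v (of_nat d) \<le> D" if "d < a" for d
    unfolding D_def using that by (intro member_le_sum) auto
  have le: "t ^ k \<le> C * real k" if "k > 0" for k
  proof -
    have "b ^ k < (a ^ c) ^ k"
      using that b by (intro power_strict_mono) auto
    then have "v (of_nat (b ^ k)) \<le> real (c * k) * D * A ^ (c * k)"
      unfolding A_def by (intro of_nat_le_digits[OF a _ D]) (simp_all add: power_mult)
    then have "v (of_nat b) ^ k \<le> real (c * k) * D * (A ^ c) ^ k"
      by (simp add: power power_mult)
    then have "t ^ k \<le> (real c * D) * real k"
      using A by (simp add: t_def power_divide divide_le_eq algebra_simps)
    also have "\<dots> \<le> C * real k"
      by (intro mult_right_mono) (auto simp: C_def)
    finally show ?thesis .
  qed
  have "eventually (\<lambda>k. t ^ k > C * real k \<and> k > 0) sequentially"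
  proof -
    have "C > 0" by (simp add: C_def)
    then have "eventually (\<lambda>k. t ^ k > C * real k) sequentially"
      using t by real_asymp
    then show ?thesis
      using eventually_gt_at_top by eventually_elim auto
  qed
  from eventually_happens'[OF sequentially_bot this]
  obtain k where "t ^ k > C * real k" "k > 0" by blast
  with le[of k] show False by simp
qed

text \<open>If some \<open>n \<ge> 2\<close> had value below 1, the maximum in
  \<open>of_nat_le_power\<close> with base \<open>n\<close> would be 1, so all natural numbers would
  have value at most 1 and \<open>v\<close> would be nonarchimedean.\<close>

lemma of_nat_ge_1:
  assumes "\<not> nonarchimedean v" "1 \<le> n"
  shows "1 \<le> v (of_nat n)"
proof (rule ccontr)
  assume less: "\<not> ?thesis"
  then have n: "2 \<le> n" using assms(2) by (cases "n = 1") auto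
  have "v (of_nat b) \<le> 1" for b
  proof -
    have "b < 2 ^ b" by simp
    also have "\<dots> \<le> n ^ b" using n by (intro power_mono) auto
    finally show ?thesis
      using of_nat_le_power[OF n] less by (simp add: max_def split: if_splits)
  qed
  then show False
    using assms(1) nonarchimedean_of_nat_le_1 by blast
qed

text \<open>For \<open>b < a\<close> a single digit in base \<open>a\<close> suffices, so
  \<open>of_nat_le_power\<close> applies with exponent 1, and \<open>of_nat_ge_1\<close> removes the
  maximum.\<close>

lemma of_nat_mono:
  assumes "\<not> nonarchimedean v" "b \<le> a"
  shows "v (of_nat b) \<le> v (of_nat a)"
proof (cases "b = a \<or> a < 2")
  case True
  with assms(2) consider "b = a" | "a = 1" "b = 0" by linarith
  then show ?thesis by cases auto
next
  case False
  then have "v (of_nat b) \<le> max 1 (v (of_nat a)) ^ 1"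
    using assms(2) by (intro of_nat_le_power) auto
  with of_nat_ge_1[OF assms(1), of a] False show ?thesis by simp
qed

end

lemma (in valued_field) of_int_eq: "v (of_int a) = v (of_nat (nat \<bar>a\<bar>))"
proof (cases "a \<ge> 0")
  case False
  have "v (of_int a) = v (of_int (- a))" unfolding of_int_minus minus by (rule refl)
  with False show ?thesis by (simp add: of_nat_nat)
qed (simp add: of_nat_nat)

text \<open>Clearing denominators leaves a comparison of two integers, which
  \<open>of_nat_mono\<close> decides. The threshold 1 is enough: \<open>of_rat_small\<close> reaches
  every other one by rescaling.\<close>

lemma of_rat_less_1:
  fixes v :: "'a::field_char_0 \<Rightarrow> real"
  assumes "absolute_value v" "\<not> nonarchimedean v" "v (of_rat q) < 1"
  shows "\<bar>q\<bar> < 1"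
proof -
  interpret valued_field v by unfold_locales fact
  obtain a b where q: "q = Fract a b" "b > 0" by (cases q)
  have "v (of_int b) > 0" using q(2) by (simp add: pos_iff)
  then have "v (of_int a) < v (of_int b)"
    using assms(3) q by (simp add: of_rat_rat divide field_simps)
  then have "nat \<bar>a\<bar> < nat \<bar>b\<bar>"
    using of_nat_mono[OF assms(2)] by (metis not_le of_int_eq)
  then show ?thesis
    using q by (simp add: Fract_of_int_quotient)
qed

section \<open>Complete fields and finite extensions\<close>

text \<open>The sort \<open>complete_space\<close> does not tie the metric to the field operations,
  and \<open>v\<close> may be nonarchimedean or a proper power of a norm, so the continuity of sums,
  products and inverses is derived from \<open>v\<close> itself.\<close>

locale valued_metric_field = valued_field v
  for v :: "'a::{field_char_0,complete_space} \<Rightarrow> real" +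
  assumes dist_eq: "dist x y = v (x - y)"
begin

lemma tendsto_iff_v: "(f \<longlongrightarrow> l) F \<longleftrightarrow> ((\<lambda>x. v (f x - l)) \<longlongrightarrow> 0) F"
  unfolding tendsto_dist_iff[of f] dist_eq by (rule refl)

lemma tendsto_v_0: "(f \<longlongrightarrow> l) F \<Longrightarrow> ((\<lambda>x. v (f x - l)) \<longlongrightarrow> 0) F"
  by (rule tendsto_iff_v[THEN iffD1])

lemma tendsto_v_le:
  assumes "(g \<longlongrightarrow> 0) F" "\<And>x. v (f x - l) \<le> g x"
  shows "(f \<longlongrightarrow> l) F"
  by (rule tendsto_iff_v[THEN iffD2], rule Lim_null_comparison[OF always_eventually assms(1)])
    (use assms(2) in simp)

lemma tendsto_plus:
  fixes f g :: "_ \<Rightarrow> 'a"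
  assumes "(f \<longlongrightarrow> a) F" "(g \<longlongrightarrow> b) F"
  shows "((\<lambda>x. f x + g x) \<longlongrightarrow> a + b) F"
proof -
  have "((\<lambda>x. v (f x - a) + v (g x - b)) \<longlongrightarrow> 0 + 0) F"
    by (intro tendsto_add tendsto_v_0 assms)
  moreover have "v ((f x + g x) - (a + b)) \<le> v (f x - a) + v (g x - b)" for x
    unfolding add_diff_add by (rule triangle)
  ultimately show ?thesis
    by (intro tendsto_v_le) (simp_all only: add_0 mult_zero_right mult_zero_left)
qed

lemma tendsto_v:
  fixes f :: "_ \<Rightarrow> 'a"
  assumes "(f \<longlongrightarrow> a) F"
  shows "((\<lambda>x. v (f x)) \<longlongrightarrow> v a) F"
  using tendsto_dist[OF assms tendsto_const[of 0]] by (simp add: dist_eq)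

lemma tendsto_times:
  fixes f g :: "_ \<Rightarrow> 'a"
  assumes "(f \<longlongrightarrow> a) F" "(g \<longlongrightarrow> b) F"
  shows "((\<lambda>x. f x * g x) \<longlongrightarrow> a * b) F"
proof -
  have "((\<lambda>x. v (f x) * v (g x - b) + v (f x - a) * v b) \<longlongrightarrow> v a * 0 + 0 * v b) F"
    by (intro tendsto_add tendsto_mult tendsto_v tendsto_v_0 assms tendsto_const)
  moreover have "v (f x * g x - a * b) \<le> v (f x) * v (g x - b) + v (f x - a) * v b" for x
  proof -
    have "f x * g x - a * b = f x * (g x - b) + (f x - a) * b"
      by (simp add: algebra_simps)
    then show ?thesis by (metis triangle mult)
  qed
  ultimately show ?thesis
    by (intro tendsto_v_le) (simp_all only: add_0 mult_zero_right mult_zero_left)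
qed

lemma tendsto_sum':
  fixes f :: "_ \<Rightarrow> _ \<Rightarrow> 'a"
  assumes "\<And>i. i \<in> I \<Longrightarrow> (f i \<longlongrightarrow> a i) F"
  shows "((\<lambda>x. \<Sum>i\<in>I. f i x) \<longlongrightarrow> (\<Sum>i\<in>I. a i)) F"
  using assms by (induction I rule: infinite_finite_induct) (auto intro: tendsto_plus)

lemma tendsto_uminus:
  fixes f :: "_ \<Rightarrow> 'a"
  assumes "(f \<longlongrightarrow> a) F"
  shows "((\<lambda>x. - f x) \<longlongrightarrow> - a) F"
  using tendsto_times[OF tendsto_const[of "- 1"] assms] by simp

lemma tendsto_inverse':
  fixes f :: "_ \<Rightarrow> 'a"
  assumes "(f \<longlongrightarrow> a) F" "a \<noteq> 0"
  shows "((\<lambda>x. inverse (f x)) \<longlongrightarrow> inverse a) F"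
proof -
  have "((\<lambda>x. v (f x - a) / (v (f x) * v a)) \<longlongrightarrow> 0 / (v a * v a)) F"
    using assms(2) by (intro tendsto_divide tendsto_mult tendsto_const tendsto_v tendsto_v_0 assms(1)) simp
  moreover have "eventually (\<lambda>x. f x \<noteq> 0) F"
    using tendsto_imp_eventually_ne[OF assms] .
  then have "eventually (\<lambda>x. v (f x - a) / (v (f x) * v a) = v (inverse (f x) - inverse a)) F"
  proof eventually_elim
    case (elim x)
    then have "inverse (f x) - inverse a = (a - f x) / (f x * a)"
      using assms(2) by (simp add: field_simps)
    then show ?case
      by (simp add: divide mult minus_commute)
  qed
  ultimately have "((\<lambda>x. v (inverse (f x) - inverse a)) \<longlongrightarrow> 0) F"
    using tendsto_cong by fastforce
  then show ?thesis
    by (simp only: tendsto_iff_v[symmetric])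
qed

lemma continuous_on_times:
  fixes f g :: "_ \<Rightarrow> 'a"
  shows "continuous_on S f \<Longrightarrow> continuous_on S g \<Longrightarrow> continuous_on S (\<lambda>x. f x * g x)"
  unfolding continuous_on_def by (auto intro!: tendsto_times)

lemma continuous_on_uminus:
  fixes f :: "_ \<Rightarrow> 'a"
  shows "continuous_on S f \<Longrightarrow> continuous_on S (\<lambda>x. - f x)"
  unfolding continuous_on_def by (auto intro!: tendsto_uminus)

end

section \<open>Linear algebra over a closed subfield\<close>

locale complete_subfield = valued_metric_field v
  for v :: "'a::{field_char_0,complete_space} \<Rightarrow> real" +
  fixes F :: "'a set"
  assumes closed: "closed F"
    and zero_in: "0 \<in> F" and one_in: "1 \<in> F"
    and plus_in: "x \<in> F \<Longrightarrow> y \<in> F \<Longrightarrow> x + y \<in> F"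
    and times_in: "x \<in> F \<Longrightarrow> y \<in> F \<Longrightarrow> x * y \<in> F"
    and uminus_in: "x \<in> F \<Longrightarrow> - x \<in> F"
    and inverse_in: "x \<in> F \<Longrightarrow> inverse x \<in> F"
begin

text \<open>The scalars form a subset of the type and not a type of their own, so spans and
  independence are expressed by explicit sums with coefficients in \<open>F\<close>.\<close>

definition lspan :: "'a set \<Rightarrow> 'a set" where
  "lspan B = {\<Sum>b\<in>B. a b * b | a. \<forall>b\<in>B. a b \<in> F}"

definition indep :: "'a set \<Rightarrow> bool" where
  "indep B \<longleftrightarrow> finite B \<and>
     (\<forall>a. (\<forall>b\<in>B. a b \<in> F) \<longrightarrow> (\<Sum>b\<in>B. a b * b) = 0 \<longrightarrow> (\<forall>b\<in>B. a b = 0))"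

lemma indepD:
  "indep B \<Longrightarrow> \<forall>b\<in>B. a b \<in> F \<Longrightarrow> (\<Sum>b\<in>B. a b * b) = 0 \<Longrightarrow> \<forall>b\<in>B. a b = 0"
  unfolding indep_def by blast

lemma minus_in: "x \<in> F \<Longrightarrow> y \<in> F \<Longrightarrow> x - y \<in> F"
  using plus_in[OF _ uminus_in] by force

lemma lspanI: "(\<And>b. b \<in> B \<Longrightarrow> a b \<in> F) \<Longrightarrow> (\<Sum>b\<in>B. a b * b) \<in> lspan B"
  unfolding lspan_def by auto

lemma lspanE:
  assumes "x \<in> lspan B"
  obtains a where "\<And>b. b \<in> B \<Longrightarrow> a b \<in> F" "x = (\<Sum>b\<in>B. a b * b)"
  using assms unfolding lspan_def by auto

lemma lspan_zero: "0 \<in> lspan B"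
  using lspanI[of B "\<lambda>_. 0"] zero_in by simp

lemma lspan_plus:
  assumes "x \<in> lspan B" "y \<in> lspan B"
  shows "x + y \<in> lspan B"
proof -
  obtain a where a: "\<And>b. b \<in> B \<Longrightarrow> a b \<in> F" "x = (\<Sum>b\<in>B. a b * b)"
    using assms(1) by (auto elim: lspanE)
  obtain c where c: "\<And>b. b \<in> B \<Longrightarrow> c b \<in> F" "y = (\<Sum>b\<in>B. c b * b)"
    using assms(2) by (auto elim: lspanE)
  have "x + y = (\<Sum>b\<in>B. (a b + c b) * b)"
    by (simp add: a(2) c(2) sum.distrib distrib_right)
  then show ?thesis using a(1) c(1) lspanI[of B "\<lambda>b. a b + c b"] plus_in by auto
qed

lemma lspan_scale:
  assumes "c \<in> F" "x \<in> lspan B"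
  shows "c * x \<in> lspan B"
proof -
  obtain a where a: "\<And>b. b \<in> B \<Longrightarrow> a b \<in> F" "x = (\<Sum>b\<in>B. a b * b)"
    using assms(2) by (auto elim: lspanE)
  have "c * x = (\<Sum>b\<in>B. (c * a b) * b)"
    by (simp add: a(2) sum_distrib_left mult.assoc)
  then show ?thesis using a(1) assms(1) lspanI[of B "\<lambda>b. c * a b"] times_in by auto
qed

lemma lspan_sum: "(\<And>i. i \<in> I \<Longrightarrow> f i \<in> lspan B) \<Longrightarrow> sum f I \<in> lspan B"
  by (induction I rule: infinite_finite_induct) (auto intro: lspan_zero lspan_plus)

lemma lspan_base:
  assumes "finite B" "b \<in> B"
  shows "b \<in> lspan B"
proof -
  have "(\<Sum>x\<in>B. (if x = b then 1 else 0) * x) = (\<Sum>x\<in>B. if x = b then b else 0)"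
    by (intro sum.cong) auto
  also have "\<dots> = b" using assms by simp
  finally show ?thesis
    using lspanI[of B "\<lambda>x. if x = b then 1 else 0"] zero_in one_in by simp
qed

lemma lspan_insert:
  assumes "finite B" "b \<notin> B"
  shows "lspan B \<subseteq> lspan (insert b B)"
proof
  fix x assume "x \<in> lspan B"
  then obtain a where a: "\<And>b. b \<in> B \<Longrightarrow> a b \<in> F" "x = (\<Sum>b\<in>B. a b * b)" by (auto elim: lspanE)
  have "x = (\<Sum>y\<in>B. (a(b := 0)) y * y)"
    unfolding a(2) using assms(2) by (intro sum.cong) auto
  also have "\<dots> = (\<Sum>y\<in>insert b B. (a(b := 0)) y * y)" using assms by simp
  also have "\<dots> \<in> lspan (insert b B)" using a(1) zero_in by (intro lspanI) auto
  finally show "x \<in> lspan (insert b B)" .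
qed

lemma indep_insert:
  assumes "indep B" "b \<notin> lspan B"
  shows "indep (insert b B)"
  unfolding indep_def
proof (intro conjI allI impI)
  show fin: "finite (insert b B)" using assms(1) by (simp add: indep_def)
  have b: "b \<notin> B" using assms lspan_base fin by auto
  fix a assume a: "\<forall>x\<in>insert b B. a x \<in> F" and "(\<Sum>x\<in>insert b B. a x * x) = 0"
  then have eq: "a b * b + (\<Sum>x\<in>B. a x * x) = 0" using fin b by simp
  have "a b = 0"
  proof (rule ccontr)
    assume ab: "a b \<noteq> 0"
    with eq have "b = - inverse (a b) * (\<Sum>x\<in>B. a x * x)"
      by (simp add: field_simps eq_neg_iff_add_eq_0)
    moreover have "\<dots> \<in> lspan B"
      using a by (intro lspan_scale lspanI uminus_in inverse_in) auto
    ultimately show False using assms(2) by simp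
  qed
  moreover have "\<forall>x\<in>B. a x = 0"
    using assms(1) a eq \<open>a b = 0\<close> unfolding indep_def by auto
  ultimately show "\<forall>x\<in>insert b B. a x = 0" by auto
qed

text \<open>Serves the induction in \<open>coordinates_bounded\<close>, which splits one vector at a
  time off a given independent set.\<close>

lemma indep_insertD:
  assumes "indep (insert b B)" "b \<notin> B"
  shows "indep B" "b \<notin> lspan B"
proof -
  have fin: "finite B" using assms(1) by (simp add: indep_def)
  have ext: "\<forall>x\<in>insert b B. a x = 0"
    if "\<forall>x\<in>insert b B. a x \<in> F" "a b * b + (\<Sum>x\<in>B. a x * x) = 0" for a
    using assms that fin unfolding indep_def by simp
  have upd: "(\<Sum>x\<in>B. (a(b := c)) x * x) = (\<Sum>x\<in>B. a x * x)" for a c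
    using assms(2) by (intro sum.cong) auto
  show "indep B"
    unfolding indep_def
  proof (intro conjI allI impI fin)
    fix a assume "\<forall>x\<in>B. a x \<in> F" "(\<Sum>x\<in>B. a x * x) = 0"
    then have "\<forall>x\<in>insert b B. (a(b := 0)) x = 0"
      using zero_in by (intro ext) (unfold upd, auto)
    then show "\<forall>x\<in>B. a x = 0" using assms(2) by (metis fun_upd_apply insertCI)
  qed
  show "b \<notin> lspan B"
  proof
    assume "b \<in> lspan B"
    then obtain a where a: "\<And>x. x \<in> B \<Longrightarrow> a x \<in> F" "b = (\<Sum>x\<in>B. a x * x)" by (auto elim: lspanE)
    have "(\<Sum>x\<in>B. (a(b := - 1)) x * x) = b"
      unfolding upd by (rule a(2)[symmetric])
    then have "\<forall>x\<in>insert b B. (a(b := - 1)) x = 0"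
      using a(1) by (intro ext) (auto intro: uminus_in one_in)
    then show False by auto
  qed
qed

text \<open>Bounded coordinates turn a convergent sequence of the span into Cauchy sequences of
  coefficients, whose limits stay in the closed set \<open>F\<close>. Stated with the bound as a
  hypothesis because the induction in \<open>coordinates_bounded\<close> needs it for the smaller
  set.\<close>

lemma closed_lspan_if_coordinates_bounded:
  assumes fin: "finite B"
    and C: "\<And>a b. (\<And>b. b \<in> B \<Longrightarrow> a b \<in> F) \<Longrightarrow> b \<in> B \<Longrightarrow> v (a b) \<le> C * v (\<Sum>b\<in>B. a b * b)"
  shows "closed (lspan B)"
  unfolding closed_sequential_limits
proof safe
  fix x l assume x: "\<forall>n. x n \<in> lspan B" "x \<longlonglongrightarrow> l"
  then have "\<exists>a. (\<forall>b\<in>B. a b \<in> F) \<and> x n = (\<Sum>b\<in>B. a b * b)" for n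
    by (metis lspanE)
  then obtain a where a: "\<And>n b. b \<in> B \<Longrightarrow> a n b \<in> F" "\<And>n. x n = (\<Sum>b\<in>B. a n b * b)"
    by metis
  have "\<exists>y. (\<lambda>n. a n b) \<longlonglongrightarrow> y \<and> y \<in> F" if b: "b \<in> B" for b
  proof -
    have le: "dist (a m b) (a n b) \<le> C * dist (x m) (x n)" for m n
    proof -
      have "v (a m b - a n b) \<le> C * v (\<Sum>b\<in>B. (a m b - a n b) * b)"
        by (rule C[where a = "\<lambda>b. a m b - a n b"]) (use a b in \<open>auto intro: minus_in\<close>)
      then show ?thesis
        by (simp add: dist_eq a(2) sum_subtractf left_diff_distrib)
    qed
    have "Cauchy (\<lambda>n. a n b)"
    proof (rule metric_CauchyI)
      fix e :: real assume e: "e > 0"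
      \<comment> \<open>The sign of \<open>C\<close> is unspecified, and the tolerance
        \<open>e / K\<close> needs a positive divisor.\<close>
      define K where "K = \<bar>C\<bar> + 1"
      define e' where "e' = e / K"
      have K: "K > 0" "C \<le> K" unfolding K_def by linarith+
      have "e' > 0" using e K by (simp add: e'_def)
      moreover have "Cauchy x" using x(2) by (rule LIMSEQ_imp_Cauchy)
      ultimately obtain N where N: "\<And>m n. m \<ge> N \<Longrightarrow> n \<ge> N \<Longrightarrow> dist (x m) (x n) < e'"
        by (metis metric_CauchyD)
      have "dist (a m b) (a n b) < e" if "m \<ge> N" "n \<ge> N" for m n
      proof -
        have "dist (a m b) (a n b) \<le> K * dist (x m) (x n)"
          by (rule order_trans[OF le mult_right_mono[OF K(2) zero_le_dist]])
        also have "\<dots> < K * e'"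
          using N[OF that] K by (intro mult_strict_left_mono) auto
        also have "\<dots> = e" using K by (simp add: e'_def)
        finally show ?thesis .
      qed
      then show "\<exists>N. \<forall>m\<ge>N. \<forall>n\<ge>N. dist (a m b) (a n b) < e" by blast
    qed
    then obtain y where y: "(\<lambda>n. a n b) \<longlonglongrightarrow> y"
      using Cauchy_convergent convergent_def by blast
    moreover have "y \<in> F"
      using closed_sequentially[OF closed _ y] a(1)[OF b] by blast
    ultimately show ?thesis by blast
  qed
  then obtain y where y: "\<And>b. b \<in> B \<Longrightarrow> (\<lambda>n. a n b) \<longlonglongrightarrow> y b" "\<And>b. b \<in> B \<Longrightarrow> y b \<in> F"
    by metis
  have "x \<longlonglongrightarrow> (\<Sum>b\<in>B. y b * b)"
    unfolding a(2)[abs_def] by (intro tendsto_sum' tendsto_times y tendsto_const)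
  with x(2) have "l = (\<Sum>b\<in>B. y b * b)" by (rule LIMSEQ_unique)
  then show "l \<in> lspan B" using lspanI y(2) by blast
qed

text \<open>
  Equivalence of norms on finite-dimensional spaces over a complete field. A vector \<open>b\<close> outside
  the span of the previous ones has positive distance from it, since the span is closed.
\<close>
lemma coordinates_bounded:
  assumes "indep B"
  shows "\<exists>C\<ge>0. \<forall>a. (\<forall>b\<in>B. a b \<in> F) \<longrightarrow> (\<forall>b\<in>B. v (a b) \<le> C * v (\<Sum>b\<in>B. a b * b))"
proof -
  have "finite B" using assms by (simp add: indep_def)
  then show ?thesis
    using assms
  proof (induction B)
    case (insert b B)
    note ins = indep_insertD[OF insert.prems insert.hyps(2)]
    obtain C where C: "C \<ge> 0" "\<And>a b. (\<And>b. b \<in> B \<Longrightarrow> a b \<in> F) \<Longrightarrow> b \<in> B \<Longrightarrow>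
        v (a b) \<le> C * v (\<Sum>b\<in>B. a b * b)"
      using insert.IH[OF ins(1)] by blast
    have "closed (lspan B)"
      using closed_lspan_if_coordinates_bounded[OF insert.hyps(1) C(2)] .
    then obtain d where d: "d > 0" "ball b d \<subseteq> - lspan B"
      using ins(2) unfolding closed_def by (metis ComplI openE)
    have d': "d \<le> v (b + y)" if "y \<in> lspan B" for y
    proof -
      have "- y \<in> lspan B"
        using lspan_scale[OF uminus_in[OF one_in] that] by simp
      then have "- y \<notin> ball b d" using d(2) by blast
      then show ?thesis by (simp add: dist_eq)
    qed
    \<comment> \<open>\<open>1 / d\<close> bounds the coefficient of \<open>b\<close>. The others
      are at most \<open>C * v s\<close>, and recovering \<open>s\<close> from the full sum by
      subtracting \<open>a b * b\<close> costs the factor \<open>1 + v b / d\<close>.\<close>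
    define C' where "C' = max (1 / d) (C * (1 + v b / d))"
    show ?case
    proof (intro exI[of _ C'] conjI allI impI ballI)
      show "0 \<le> C'" using d(1) by (simp add: C'_def le_max_iff_disj)
      fix a y assume a: "\<forall>x\<in>insert b B. a x \<in> F" and y: "y \<in> insert b B"
      define s where "s = (\<Sum>x\<in>B. a x * x)"
      have s: "s \<in> lspan B" unfolding s_def using a by (intro lspanI) auto
      have sum: "(\<Sum>x\<in>insert b B. a x * x) = a b * b + s"
        using insert.hyps by (simp add: s_def)
      \<comment> \<open>After division by \<open>a b\<close> the sum becomes \<open>b\<close> plus
        an element of the span of \<open>B\<close>, which has value at least
        \<open>d\<close>.\<close>
      have b: "v (a b) \<le> 1 / d * v (a b * b + s)"
      proof (cases "a b = 0")
        case False
        then have "a b * b + s = a b * (b + inverse (a b) * s)"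
          by (simp add: field_simps)
        moreover have "d \<le> v (b + inverse (a b) * s)"
          using a by (intro d' lspan_scale[OF inverse_in] s) auto
        then have "v (a b) * d \<le> v (a b) * v (b + inverse (a b) * s)"
          by (intro mult_left_mono) auto
        ultimately have "v (a b) * d \<le> v (a b * b + s)" by (simp add: mult)
        then show ?thesis using d(1) by (simp add: field_simps)
      qed (use d(1) in simp)
      show "v (a y) \<le> C' * v (\<Sum>x\<in>insert b B. a x * x)"
      proof (cases "y = b")
        case True
        have "1 / d * v (a b * b + s) \<le> C' * v (a b * b + s)"
          by (intro mult_right_mono) (auto simp: C'_def)
        with b True show ?thesis unfolding sum by simp
      next
        case False
        then have "y \<in> B" using y by simp
        then have "v (a y) \<le> C * v s"
          unfolding s_def using a by (intro C(2)) auto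
        also have "v s \<le> v (a b * b + s) + v (a b) * v b"
          using triangle[of "a b * b + s" "- (a b * b)"] unfolding minus mult by simp
        also have "\<dots> \<le> v (a b * b + s) + (1 / d * v (a b * b + s)) * v b"
          by (intro add_left_mono mult_right_mono b) auto
        also have "C * \<dots> = (C * (1 + v b / d)) * v (a b * b + s)"
          by (simp add: field_simps)
        also have "\<dots> \<le> C' * v (a b * b + s)"
          by (intro mult_right_mono) (auto simp: C'_def)
        finally show ?thesis unfolding sum using C(1) by (simp add: mult_left_mono)
      qed
    qed
  qed auto
qed

lemma closed_lspan:
  assumes "indep B"
  shows "closed (lspan B)"
proof -
  have "finite B" using assms by (simp add: indep_def)
  then show ?thesis
    using coordinates_bounded[OF assms] closed_lspan_if_coordinates_bounded by metis
qed

lemma exists_indep_subset: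
  assumes "finite S"
  shows "\<exists>B. indep B \<and> S \<subseteq> lspan B"
  using assms
proof (induction S)
  case empty
  then show ?case by (auto simp: indep_def intro!: exI[of _ "{}"])
next
  case (insert s S)
  then obtain B where B: "indep B" "S \<subseteq> lspan B" by blast
  show ?case
  proof (cases "s \<in> lspan B")
    case False
    have "finite B" using B(1) by (simp add: indep_def)
    then show ?thesis
      using B False indep_insert[OF B(1) False] lspan_insert lspan_base[of "insert s B" s]
        lspan_base[of B s] by (intro exI[of _ "insert s B"]) blast
  qed (use B in auto)
qed

lemma basis_over_indep:
  assumes "basis_over F B"
  shows "indep B"
  unfolding indep_def
proof (intro conjI allI impI)
  show "finite B" using assms by (simp add: basis_over_def)
  fix a assume a: "\<forall>b\<in>B. a b \<in> F" "(\<Sum>b\<in>B. a b * b) = 0"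
  have "\<exists>!a. a \<in> B \<rightarrow>\<^sub>E F \<and> 0 = (\<Sum>b\<in>B. a b * b)"
    using assms unfolding basis_over_def by blast
  moreover have "restrict a B \<in> B \<rightarrow>\<^sub>E F \<and> 0 = (\<Sum>b\<in>B. restrict a B b * b)"
    using a by (auto simp: PiE_iff)
  moreover have "restrict (\<lambda>_. 0) B \<in> B \<rightarrow>\<^sub>E F \<and> 0 = (\<Sum>b\<in>B. restrict (\<lambda>_. 0) B b * b)"
    using zero_in by (auto simp: PiE_iff)
  ultimately have "restrict a B = restrict (\<lambda>_. 0) B" by blast
  then show "\<forall>b\<in>B. a b = 0" by (metis restrict_apply')
qed

lemma basis_overI:
  assumes "indep B" "lspan B = UNIV"
  shows "basis_over F B"
  unfolding basis_over_def
proof (intro conjI allI ex_ex1I)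
  show "finite B" using assms by (simp add: indep_def)
  fix x
  obtain a where a: "\<And>b. b \<in> B \<Longrightarrow> a b \<in> F" "x = (\<Sum>b\<in>B. a b * b)"
    using assms(2) lspanE[of x B] by auto
  then show "\<exists>a. a \<in> B \<rightarrow>\<^sub>E F \<and> x = (\<Sum>b\<in>B. a b * b)"
    by (intro exI[of _ "restrict a B"]) auto
  fix a a' assume a: "a \<in> B \<rightarrow>\<^sub>E F \<and> x = (\<Sum>b\<in>B. a b * b)"
    and a': "a' \<in> B \<rightarrow>\<^sub>E F \<and> x = (\<Sum>b\<in>B. a' b * b)"
  then have "(\<Sum>b\<in>B. (a b - a' b) * b) = 0"
    by (simp add: left_diff_distrib sum_subtractf)
  moreover have "\<forall>b\<in>B. a b - a' b \<in> F"
    using a a' minus_in by (auto simp: PiE_iff)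
  ultimately have "\<forall>b\<in>B. a b - a' b = 0"
    using indepD[OF assms(1), of "\<lambda>b. a b - a' b"] by blast
  then show "a = a'"
    using a a' by (intro PiE_ext[of a B "\<lambda>_. F"]) auto
qed

lemma coords:
  assumes "basis_over F B"
  shows "\<And>b. b \<in> B \<Longrightarrow> coords F B x b \<in> F" "x = (\<Sum>b\<in>B. coords F B x b * b)"
proof -
  have "\<exists>!a. a \<in> B \<rightarrow>\<^sub>E F \<and> x = (\<Sum>b\<in>B. a b * b)"
    using assms unfolding basis_over_def by blast
  from theI'[OF this, folded coords_def]
  have "coords F B x \<in> B \<rightarrow>\<^sub>E F \<and> x = (\<Sum>b\<in>B. coords F B x b * b)" .
  then show "\<And>b. b \<in> B \<Longrightarrow> coords F B x b \<in> F" "x = (\<Sum>b\<in>B. coords F B x b * b)"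
    by auto
qed

text \<open>Whichever basis the choice operator selects, its coordinates are Lipschitz by
  \<open>coordinates_bounded\<close>. The trace is a finite sum of them, taken at
  \<open>x * b\<close>, whence the constant \<open>\<Sum>b\<in>B'. C * v b\<close>.\<close>

lemma field_trace:
  assumes "basis_over F B"
  shows "field_trace F x \<in> F" "\<exists>C\<ge>0. \<forall>x y. dist (field_trace F x) (field_trace F y) \<le> C * dist x y"
proof -
  define B' where "B' = (SOME B. basis_over F B)"
  have B': "basis_over F B'"
    unfolding B'_def using assms by (rule someI)
  have tr: "field_trace F x = (\<Sum>b\<in>B'. coords F B' (x * b) b)" for x
    by (simp add: field_trace_def B'_def Let_def)
  have sum_in: "(\<And>b. b \<in> A \<Longrightarrow> f b \<in> F) \<Longrightarrow> sum f A \<in> F" for f and A :: "'a set"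
    by (induction A rule: infinite_finite_induct) (auto intro: zero_in plus_in)
  show "field_trace F x \<in> F"
    unfolding tr by (intro sum_in coords B')
  obtain C where C: "C \<ge> 0" "\<And>a b. (\<And>b. b \<in> B' \<Longrightarrow> a b \<in> F) \<Longrightarrow> b \<in> B' \<Longrightarrow>
      v (a b) \<le> C * v (\<Sum>b\<in>B'. a b * b)"
    using coordinates_bounded[OF basis_over_indep[OF B']] by blast
  have lip: "v (coords F B' x b - coords F B' y b) \<le> C * v (x - y)" if "b \<in> B'" for x y b
  proof -
    have "x - y = (\<Sum>b\<in>B'. (coords F B' x b - coords F B' y b) * b)"
      using coords(2)[OF B', of x] coords(2)[OF B', of y]
      by (simp add: left_diff_distrib sum_subtractf)
    moreover have "v (coords F B' x b - coords F B' y b)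
        \<le> C * v (\<Sum>b\<in>B'. (coords F B' x b - coords F B' y b) * b)"
      by (rule C(2)[where a = "\<lambda>b. coords F B' x b - coords F B' y b"])
        (auto intro: minus_in coords[OF B'] that)
    ultimately show ?thesis by simp
  qed
  have "dist (field_trace F x) (field_trace F y) \<le> (\<Sum>b\<in>B'. C * v b) * dist x y" for x y
  proof -
    have "dist (field_trace F x) (field_trace F y)
        = v (\<Sum>b\<in>B'. coords F B' (x * b) b - coords F B' (y * b) b)"
      by (simp add: tr dist_eq sum_subtractf)
    also have "\<dots> \<le> (\<Sum>b\<in>B'. v (coords F B' (x * b) b - coords F B' (y * b) b))"
      by (rule sum_le)
    also have "\<dots> \<le> (\<Sum>b\<in>B'. C * v b * dist x y)"
    proof (rule sum_mono)
      fix b assume "b \<in> B'"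
      then have "v (coords F B' (x * b) b - coords F B' (y * b) b) \<le> C * v (x * b - y * b)"
        by (rule lip)
      also have "x * b - y * b = (x - y) * b" by (simp add: algebra_simps)
      finally show "v (coords F B' (x * b) b - coords F B' (y * b) b) \<le> C * v b * dist x y"
        unfolding dist_eq mult by (simp add: ac_simps)
    qed
    finally show ?thesis by (simp add: sum_distrib_right)
  qed
  then show "\<exists>C\<ge>0. \<forall>x y. dist (field_trace F x) (field_trace F y) \<le> C * dist x y"
    using C(1) by (intro exI[of _ "\<Sum>b\<in>B'. C * v b"]) (auto intro!: sum_nonneg)
qed

end

section \<open>The closure of the rationals and continuity of the additive character\<close>

context valued_metric_field
begin

lemma base_field_sequential:
  "x \<in> base_field \<longleftrightarrow> (\<exists>s :: nat \<Rightarrow> rat. (\<lambda>n. of_rat (s n)) \<longlonglongrightarrow> x)" for x :: 'a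
proof
  assume "x \<in> base_field"
  then obtain t where t: "\<forall>n. t n \<in> range of_rat" "t \<longlonglongrightarrow> x"
    unfolding base_field_def closure_sequential by blast
  then have "\<forall>n. \<exists>q. t n = of_rat q" by blast
  then obtain s where "\<forall>n. t n = of_rat (s n)" by (rule choice[THEN exE])
  then have "t = (\<lambda>n. of_rat (s n))" by blast
  with t(2) show "\<exists>s :: nat \<Rightarrow> rat. (\<lambda>n. of_rat (s n)) \<longlonglongrightarrow> x" by blast
next
  assume "\<exists>s :: nat \<Rightarrow> rat. (\<lambda>n. of_rat (s n)) \<longlonglongrightarrow> x"
  then obtain s :: "nat \<Rightarrow> rat" where "(\<lambda>n. of_rat (s n)) \<longlonglongrightarrow> x" by blast
  then show "x \<in> base_field"
    unfolding base_field_def closure_sequential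
    by (intro exI[of _ "\<lambda>n. of_rat (s n)"]) simp
qed

lemma base_fieldI: "(\<lambda>n. of_rat (s n)) \<longlonglongrightarrow> x \<Longrightarrow> x \<in> base_field" for x :: 'a
  unfolding base_field_sequential by blast

lemma base_fieldE:
  fixes x :: 'a
  assumes "x \<in> base_field"
  obtains s :: "nat \<Rightarrow> rat" where "(\<lambda>n. of_rat (s n)) \<longlonglongrightarrow> x"
  using assms unfolding base_field_sequential by blast

lemma complete_subfield_base_field: "complete_subfield v base_field"
proof
  have rat: "of_rat q \<in> base_field" for q
    unfolding base_field_def using closure_subset by fast
  show "closed (base_field :: 'a set)" by (simp add: base_field_def)
  show "0 \<in> (base_field :: 'a set)" "1 \<in> (base_field :: 'a set)"
    using rat[of 0] rat[of 1] by simp_all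
  fix x :: 'a assume "x \<in> base_field"
  then obtain s where s: "(\<lambda>n. of_rat (s n)) \<longlonglongrightarrow> x" by (rule base_fieldE)
  show "- x \<in> base_field"
    using tendsto_uminus[OF s] by (intro base_fieldI[of "\<lambda>n. - s n"]) (simp add: of_rat_minus)
  show "inverse x \<in> base_field"
  proof (cases "x = 0")
    case False
    show ?thesis
      using tendsto_inverse'[OF s False] by (intro base_fieldI[of "\<lambda>n. inverse (s n)"]) (simp add: of_rat_inverse)
  qed (use rat[of 0] in simp)
  fix y :: 'a assume "y \<in> base_field"
  then obtain t where t: "(\<lambda>n. of_rat (t n)) \<longlonglongrightarrow> y" by (rule base_fieldE)
  show "x + y \<in> base_field"
    using tendsto_plus[OF s t] by (intro base_fieldI[of "\<lambda>n. s n + t n"]) (simp add: of_rat_add)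
  show "x * y \<in> base_field"
    using tendsto_times[OF s t] by (intro base_fieldI[of "\<lambda>n. s n * t n"]) (simp add: of_rat_mult)
qed

text \<open>The span of \<open>S\<close> over the base field is closed and contains a dense set.\<close>
lemma exists_basis_over_base_field:
  fixes S :: "'a set"
  assumes "finite S" "closure D = UNIV"
    and D: "\<And>x. x \<in> D \<Longrightarrow> \<exists>q. x = (\<Sum>s\<in>S. of_rat (q s) * s)"
  shows "\<exists>B :: 'a set. basis_over base_field B"
proof -
  interpret base: complete_subfield v base_field by (rule complete_subfield_base_field)
  obtain B where B: "base.indep B" "S \<subseteq> base.lspan B"
    using base.exists_indep_subset[OF assms(1)] by blast
  have "D \<subseteq> base.lspan B"
  proof
    fix x assume "x \<in> D"
    then obtain q where x: "x = (\<Sum>s\<in>S. of_rat (q s) * s)" using D by blast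
    have "of_rat (q s) \<in> base_field" for s :: 'a
      unfolding base_field_def using closure_subset by fast
    then show "x \<in> base.lspan B"
      unfolding x using B(2) by (intro base.lspan_sum base.lspan_scale) auto
  qed
  then have "closure D \<subseteq> base.lspan B"
    by (rule closure_minimal) (rule base.closed_lspan[OF B(1)])
  then show ?thesis
    using base.basis_overI[OF B(1)] assms(2) by blast
qed

text \<open>By the ultrametric inequality the conditions under the two description operators are the
  same predicate, so the descriptions coincide as they stand.\<close>

lemma padic_frac_cong:
  assumes "nonarchimedean v" "v (x - y) \<le> 1"
  shows "padic_frac v x = padic_frac v y"
proof -
  have *: "v (x - z) \<le> 1 \<longleftrightarrow> v (y - z) \<le> 1" for z
  proof -
    have "v (x - z) \<le> max (v (x - y)) (v (y - z))" "v (y - z) \<le> max (v (y - x)) (v (x - z))"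
      using assms(1) unfolding nonarchimedean_def by (metis diff_add_cancel add_diff_eq)+
    then show ?thesis
      using assms(2) by (auto simp: minus_commute[of y x])
  qed
  show ?thesis
    unfolding padic_frac_def * by (rule refl)
qed

text \<open>Multiplication by some \<open>N > 1 / e\<close> moves the threshold to 1, where
  \<open>of_rat_less_1\<close> applies; accordingly \<open>d\<close> is the value of
  \<open>1 / N\<close>.\<close>

lemma of_rat_small:
  assumes "\<not> nonarchimedean v" "e > 0"
  shows "\<exists>d>0. \<forall>q. v (of_rat q) < d \<longrightarrow> \<bar>of_rat q :: real\<bar> < e"
proof -
  obtain N where N: "N > 0" "inverse (real N) < e"
    using reals_Archimedean[OF assms(2)] by (metis of_nat_Suc zero_less_Suc)
  have vN: "v (of_nat N) > 0" using N(1) by (simp add: pos_iff)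
  show ?thesis
  proof (intro exI[of _ "inverse (v (of_nat N))"] conjI allI impI)
    fix q assume "v (of_rat q) < inverse (v (of_nat N))"
    then have "v (of_rat (q * of_nat N)) < 1"
      using vN by (simp add: of_rat_mult mult field_simps)
    then have "\<bar>q * of_nat N\<bar> < 1"
      using of_rat_less_1[OF absolute_value assms(1)] by blast
    then have "\<bar>of_rat (q * of_nat N) :: real\<bar> < 1"
      by (metis abs_less_iff of_rat_1 of_rat_less of_rat_minus)
    then have "\<bar>of_rat q :: real\<bar> < inverse (real N)"
      using N(1) by (simp add: of_rat_mult abs_mult field_simps)
    then show "\<bar>of_rat q :: real\<bar> < e" using N(2) by linarith
  qed (use vN in simp)
qed

lemma of_rat_smallE:
  assumes "\<not> nonarchimedean v" "e > 0"
  obtains d where "d > 0" "\<And>q. v (of_rat q) < d \<Longrightarrow> \<bar>of_rat q :: real\<bar> < e"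
  using of_rat_small[OF assms] by blast

text \<open>Carries \<open>of_rat_small\<close> from rationals to limits. It serves twice: with
  \<open>x = y\<close> it makes \<open>to_real\<close> well defined, and with \<open>x\<close> close
  to \<open>y\<close> it makes \<open>to_real\<close> uniformly continuous.\<close>

lemma real_limits_close:
  fixes s t :: "nat \<Rightarrow> rat"
  assumes d: "\<And>q. v (of_rat q) < d \<Longrightarrow> \<bar>of_rat q :: real\<bar> < e"
    and s: "(\<lambda>n. of_rat (s n)) \<longlonglongrightarrow> x" "(\<lambda>n. of_rat (s n)) \<longlonglongrightarrow> a"
    and t: "(\<lambda>n. of_rat (t n)) \<longlonglongrightarrow> y" "(\<lambda>n. of_rat (t n)) \<longlonglongrightarrow> b"
    and "v (x - y) < d"
  shows "\<bar>a - b\<bar> \<le> e"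
proof -
  have "(\<lambda>n. v (of_rat (s n) - of_rat (t n))) \<longlonglongrightarrow> v (x - y)"
    using tendsto_v[OF tendsto_plus[OF s(1) tendsto_uminus[OF t(1)]]] by simp
  then have "eventually (\<lambda>n. v (of_rat (s n) - of_rat (t n)) < d) sequentially"
    using assms(6) by (rule order_tendstoD)
  then have "eventually (\<lambda>n. \<bar>of_rat (s n) - of_rat (t n)\<bar> \<le> e) sequentially"
  proof eventually_elim
    case (elim n)
    then show ?case
      using d[of "s n - t n"] by (simp add: of_rat_diff)
  qed
  moreover have "(\<lambda>n. \<bar>of_rat (s n) - of_rat (t n)\<bar>) \<longlonglongrightarrow> \<bar>a - b\<bar>"
    by (intro tendsto_intros s t)
  ultimately show ?thesis
    by (intro tendsto_upperbound) auto
qed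

text \<open>A rational sequence that is Cauchy for \<open>v\<close> is Cauchy in the reals by
  \<open>of_rat_small\<close>, which gives existence. Two sequences with the same limit
  \<open>x\<close> have real limits closer than every \<open>e\<close>, which gives uniqueness and
  so justifies the description.\<close>

lemma to_real:
  fixes x :: 'a
  assumes "\<not> nonarchimedean v" "x \<in> base_field"
  shows "\<exists>s :: nat \<Rightarrow> rat. (\<lambda>n. of_rat (s n)) \<longlonglongrightarrow> x \<and> (\<lambda>n. of_rat (s n)) \<longlonglongrightarrow> to_real x"
proof -
  obtain s :: "nat \<Rightarrow> rat" where s: "(\<lambda>n. of_rat (s n)) \<longlonglongrightarrow> x"
    using assms(2) by (rule base_fieldE)
  have "Cauchy (\<lambda>n. of_rat (s n) :: real)"
  proof (rule metric_CauchyI)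
    fix e :: real assume "e > 0"
    obtain d where d: "d > 0" "\<And>q. v (of_rat q) < d \<Longrightarrow> \<bar>of_rat q :: real\<bar> < e"
      using of_rat_smallE[OF assms(1) \<open>e > 0\<close>] by blast
    obtain N where N: "\<And>m n. m \<ge> N \<Longrightarrow> n \<ge> N \<Longrightarrow> dist (of_rat (s m) :: 'a) (of_rat (s n)) < d"
      using metric_CauchyD[OF LIMSEQ_imp_Cauchy[OF s] d(1)] by blast
    have "dist (of_rat (s m) :: real) (of_rat (s n)) < e" if "m \<ge> N" "n \<ge> N" for m n
      using d(2)[of "s m - s n"] N[OF that] by (simp add: dist_eq dist_real_def of_rat_diff)
    then show "\<exists>N. \<forall>m\<ge>N. \<forall>n\<ge>N. dist (of_rat (s m) :: real) (of_rat (s n)) < e" by blast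
  qed
  then obtain a :: real where a: "(\<lambda>n. of_rat (s n)) \<longlonglongrightarrow> a"
    using Cauchy_convergent convergent_def by blast
  have uniq: "b = a" if "(\<lambda>n. of_rat (t n)) \<longlonglongrightarrow> x" "(\<lambda>n. of_rat (t n)) \<longlonglongrightarrow> b" for t and b :: real
  proof -
    have "\<bar>b - a\<bar> \<le> e" if "e > 0" for e
    proof -
      obtain d where d: "d > 0" "\<And>q. v (of_rat q) < d \<Longrightarrow> \<bar>of_rat q :: real\<bar> < e"
        using of_rat_smallE[OF assms(1) \<open>e > 0\<close>] by blast
      then show ?thesis
        using real_limits_close[OF d(2) \<open>(\<lambda>n. of_rat (t n)) \<longlonglongrightarrow> x\<close> \<open>(\<lambda>n. of_rat (t n)) \<longlonglongrightarrow> b\<close> s a] d(1)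
        by simp
    qed
    then have "\<bar>b - a\<bar> \<le> 0" by (rule field_le_epsilon) simp
    then show ?thesis by simp
  qed
  have "to_real x = a"
    unfolding to_real_def
  proof (rule the_equality)
    show "\<exists>s :: nat \<Rightarrow> rat. (\<lambda>n. of_rat (s n)) \<longlonglongrightarrow> x \<and> (\<lambda>n. of_rat (s n)) \<longlonglongrightarrow> a"
      using s a by blast
  qed (use uniq in blast)
  with s a show ?thesis by blast
qed

text \<open>At a nonarchimedean place the fractional part is constant on cosets of the unit ball, so
  \<open>d = 1\<close> serves every \<open>e\<close>; at an archimedean place the modulus of
  continuity is inherited from the rationals.\<close>

lemma frac_part_uniformly_continuous:
  assumes "e > 0"
  shows "\<exists>d>0. \<forall>x\<in>base_field. \<forall>y\<in>base_field.
    v (x - y) < d \<longrightarrow> \<bar>frac_part v x - frac_part v y\<bar> \<le> e"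
proof (cases "nonarchimedean v")
  case True
  show ?thesis
  proof (intro exI[of _ 1] conjI ballI impI)
    fix x y assume "v (x - y) < 1"
    then have "padic_frac v x = padic_frac v y"
      by (intro padic_frac_cong[OF True]) simp
    then show "\<bar>frac_part v x - frac_part v y\<bar> \<le> e"
      using assms by (simp add: frac_part_def True)
  qed simp
next
  case False
  then obtain d where d: "d > 0" "\<And>q. v (of_rat q) < d \<Longrightarrow> \<bar>of_rat q :: real\<bar> < e"
    using of_rat_smallE[OF False assms] by blast
  have "\<bar>to_real x - to_real y\<bar> \<le> e"
    if xy: "x \<in> base_field" "y \<in> base_field" "v (x - y) < d" for x y
  proof -
    obtain s t :: "nat \<Rightarrow> rat"
      where s: "(\<lambda>n. of_rat (s n)) \<longlonglongrightarrow> x" "(\<lambda>n. of_rat (s n)) \<longlonglongrightarrow> to_real x"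
        and t: "(\<lambda>n. of_rat (t n)) \<longlonglongrightarrow> y" "(\<lambda>n. of_rat (t n)) \<longlonglongrightarrow> to_real y"
      using to_real[OF False xy(1)] to_real[OF False xy(2)] by blast
    show ?thesis
      by (rule real_limits_close[OF d(2) s t xy(3)])
  qed
  then show ?thesis
    using d(1) False by (intro exI[of _ d]) (simp add: frac_part_def)
qed

lemma continuous_on_add_char:
  assumes "basis_over (base_field :: 'a set) B"
  shows "continuous_on UNIV (add_char v)"
proof -
  interpret base: complete_subfield v base_field by (rule complete_subfield_base_field)
  obtain C where C: "C \<ge> 0"
    "\<And>x y :: 'a. dist (field_trace base_field x) (field_trace base_field y) \<le> C * dist x y"
    using base.field_trace(2)[OF assms] by blast
  have "continuous_on UNIV (\<lambda>x. frac_part v (field_trace base_field x))"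
    unfolding continuous_on_iff
  proof (intro ballI allI impI)
    fix x :: 'a and e :: real assume "0 < e"
    then obtain d where d: "d > 0" "\<And>x y. x \<in> base_field \<Longrightarrow> y \<in> base_field \<Longrightarrow>
        v (x - y) < d \<Longrightarrow> \<bar>frac_part v x - frac_part v y\<bar> \<le> e / 2"
      using frac_part_uniformly_continuous[of "e / 2"] by auto
    \<comment> \<open>The divisor \<open>C + 1\<close> allows for \<open>C = 0\<close>, and the
      bound \<open>e / 2\<close> leaves room for the strict inequality.\<close>
    have "dist (frac_part v (field_trace base_field y)) (frac_part v (field_trace base_field x)) < e"
      if "dist y x < d / (C + 1)" for y
    proof -
      have "dist (field_trace base_field y) (field_trace base_field x) \<le> C * dist y x"
        by (rule C)
      also have "\<dots> \<le> (C + 1) * dist y x"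
        by (intro mult_right_mono) auto
      also have "\<dots> < d" using that C(1) by (simp add: field_simps)
      finally have "\<bar>frac_part v (field_trace base_field y) - frac_part v (field_trace base_field x)\<bar> \<le> e / 2"
        using base.field_trace(1)[OF assms] by (intro d(2)) (auto simp: dist_eq)
      then show ?thesis using \<open>0 < e\<close> by (simp add: dist_real_def)
    qed
    then show "\<exists>d>0. \<forall>y\<in>UNIV. dist y x < d \<longrightarrow>
        dist (frac_part v (field_trace base_field y)) (frac_part v (field_trace base_field x)) < e"
      using d(1) C(1) by (intro exI[of _ "d / (C + 1)"]) auto
  qed
  then show ?thesis
    unfolding add_char_def by (intro continuous_intros)
qed

end

lemma norm_add_char [simp]: "cmod (add_char v x) = 1"
proof -
  have "add_char v x = cis (2 * pi * frac_part v (field_trace base_field x))"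
    by (simp add: add_char_def cis_conv_exp mult_ac)
  then show ?thesis by simp
qed

section \<open>Extension of the branches to the completion\<close>

text \<open>If \<open>w\<close> were trivial on the rationals, expansion in a finite rational basis
  would bound it on the whole field. Powers then force \<open>w x \<le> 1\<close>, and inverses
  force \<open>w x = 1\<close> for all nonzero \<open>x\<close>.\<close>

lemma nontrivial_abs_on_rat:
  fixes w :: "'k::field_char_0 \<Rightarrow> real"
  assumes "number_field TYPE('k)" "absolute_value w" "nontrivial_abs w"
  shows "\<exists>a. a \<noteq> 0 \<and> w (of_rat a) < 1"
proof (rule ccontr)
  assume contr: "\<not> ?thesis"
  interpret valued_field w by unfold_locales fact
  obtain B where "finite_dimensional_vector_space (rat_scale :: rat \<Rightarrow> 'k \<Rightarrow> 'k) B"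
    using assms(1) unfolding number_field_def by blast
  then interpret V: finite_dimensional_vector_space "rat_scale :: rat \<Rightarrow> 'k \<Rightarrow> 'k" B .
  have rat: "w (of_rat a) \<le> 1" for a
  proof (cases "a = 0")
    case False
    then have "w (of_rat (inverse a)) \<ge> 1"
      using contr by (meson not_le inverse_nonzero_iff_nonzero)
    then show ?thesis by (simp add: of_rat_inverse inverse one_le_inverse_iff)
  qed simp
  define C where "C = (\<Sum>b\<in>B. w b)"
  have le_C: "w x \<le> C" for x
  proof -
    have "x \<in> V.span B" using V.span_Basis by simp
    then obtain u where x: "x = (\<Sum>b\<in>B. rat_scale (u b) b)"
      unfolding V.span_finite[OF V.finite_Basis] by blast
    have "w x \<le> (\<Sum>b\<in>B. w (rat_scale (u b) b))" unfolding x by (rule sum_le)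
    also have "\<dots> \<le> C"
      unfolding C_def using rat by (intro sum_mono) (simp add: rat_scale_def mult mult_left_le_one_le)
    finally show ?thesis .
  qed
  have le_1: "w x \<le> 1" for x
  proof (rule ccontr)
    assume "\<not> w x \<le> 1"
    then obtain n where "C < w x ^ n" using real_arch_pow by (metis not_le)
    then show False using le_C[of "x ^ n"] by (simp add: power)
  qed
  have "w x = 1" if "x \<noteq> 0" for x
  proof (rule antisym[OF le_1])
    have "w x > 0" using that by (simp add: pos_iff)
    then show "1 \<le> w x" using le_1[of "inverse x"] by (simp add: inverse inverse_le_1_iff)
  qed
  then show False using assms(3) unfolding nontrivial_abs_def by blast
qed

lemma rat_linear_simps:
  assumes "rat_linear r"
  shows "r (x + y) = r x + r y" "r (of_rat a * x) = of_rat a * r x" "r 0 = 0" "r (x - y) = r x - r y"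
proof -
  interpret Vector_Spaces.linear rat_scale rat_scale r
    using assms by (simp add: rat_linear_def)
  show "r (x + y) = r x + r y" "r 0 = 0" "r (x - y) = r x - r y"
    by (rule add zero diff)+
  show "r (of_rat a * x) = of_rat a * r x"
    using scale[of a x] by (simp add: rat_scale_def)
qed

text \<open>Injectivity gives \<open>r 1 \<noteq> 0\<close>, and 1 is among the points of the
  supremum. Positivity later prevents a zero factor of \<rho> from masking an infinite one.\<close>

lemma op_norm_pos:
  assumes "absolute_value w" "rat_linear r" "inj r"
  shows "op_norm w r > 0"
proof -
  interpret valued_field w by unfold_locales fact
  have "r 1 \<noteq> 0"
    using rat_linear_simps(3)[OF assms(2)] assms(3) by (metis injD zero_neq_one)
  then have "0 < ennreal (w (r 1) / w 1)" by (simp add: pos_iff)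
  also have "\<dots> \<le> op_norm w r"
    unfolding op_norm_def by (rule SUP_upper) simp
  finally show ?thesis .
qed

text \<open>Scaling by powers of a small rational reduces to the unit ball.\<close>
lemma op_norm_bound:
  fixes w :: "'k::field_char_0 \<Rightarrow> real"
  assumes "number_field TYPE('k)" "absolute_value w" "nontrivial_abs w"
    and r: "rat_linear r" "op_norm w r < \<infinity>"
  shows "w (r z) \<le> enn2real (op_norm w r) * w z"
proof (cases "z = 0")
  case True
  interpret valued_field w by unfold_locales fact
  show ?thesis using True rat_linear_simps(3)[OF r(1)] by simp
next
  case False
  interpret valued_field w by unfold_locales fact
  obtain a where a: "a \<noteq> 0" "w (of_rat a) < 1"
    using nontrivial_abs_on_rat[OF assms(1-3)] by blast
  have wz: "w z > 0" using False by (simp add: pos_iff)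
  obtain n where n: "w (of_rat a) ^ n < inverse (w z)"
    using real_arch_pow_inv[OF _ a(2), of "inverse (w z)"] wz by auto
  define z' where "z' = of_rat (a ^ n) * z"
  have wz': "w z' = w (of_rat a) ^ n * w z" "w (r z') = w (of_rat a) ^ n * w (r z)"
    unfolding z'_def rat_linear_simps(2)[OF r(1)] mult by (simp_all add: of_rat_power power)
  have wa: "w (of_rat a) ^ n > 0" using a(1) by (simp add: pos_iff)
  have "0 < w z' \<and> w z' \<le> 1"
    using n wz wa by (simp add: wz' field_simps)
  then have "ennreal (w (r z') / w z') \<le> op_norm w r"
    unfolding op_norm_def by (intro SUP_upper) auto
  then have "w (r z') / w z' \<le> enn2real (op_norm w r)"
    using enn2real_mono[OF _ r(2)[unfolded infinity_ennreal_def]] by (metis enn2real_ennreal nonneg divide_nonneg_nonneg)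
  then show ?thesis
    using wz wa a(1) by (simp add: wz' field_simps)
qed

text \<open>The estimate \<open>lip\<close> makes the map well defined on
  \<open>range \<iota>\<close>, extends it to the closure and yields continuity. Two continuous
  solutions agree on a closed set containing the dense range, so the description is unique.\<close>

lemma extend_cont_lipschitz:
  fixes \<iota> :: "'k \<Rightarrow> 'l::complete_space"
  assumes dense: "closure (range \<iota>) = UNIV" and R: "R \<ge> 0"
    and lip: "\<And>z z'. dist (\<iota> (f z)) (\<iota> (f z')) \<le> R * dist (\<iota> z) (\<iota> z')"
  shows "extend_cont \<iota> f (\<iota> z) = \<iota> (f z)"
    and "dist (extend_cont \<iota> f x) (extend_cont \<iota> f y) \<le> R * dist x y"
proof -
  \<comment> \<open>\<open>\<iota>\<close> is not assumed injective here; the chosen preimage is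
    harmless because \<open>lip\<close> at distance 0 equates the values at any two
    preimages.\<close>
  define g where "g x = \<iota> (f (SOME z. \<iota> z = x))" for x
  have g: "g (\<iota> z) = \<iota> (f z)" for z
  proof -
    have "\<iota> (SOME z'. \<iota> z' = \<iota> z) = \<iota> z" by (rule someI) simp
    then show ?thesis
      using lip[of "SOME z'. \<iota> z' = \<iota> z" z] by (simp add: g_def)
  qed
  have "R-lipschitz_on (range \<iota>) g"
    by (rule lipschitz_onI) (auto simp: g lip R)
  then obtain G where G: "R-lipschitz_on UNIV G" "\<And>z. G (\<iota> z) = \<iota> (f z)"
    using lipschitz_extend_closure[of R "range \<iota>" g] g unfolding dense by auto
  have cont: "continuous_on UNIV G"
    using G(1) by (rule lipschitz_on_continuous_on)
  have "extend_cont \<iota> f = G"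
    unfolding extend_cont_def
  proof (rule the_equality)
    show "continuous_on UNIV G \<and> (\<forall>z. G (\<iota> z) = \<iota> (f z))" using cont G(2) by blast
    fix F assume F: "continuous_on UNIV F \<and> (\<forall>z. F (\<iota> z) = \<iota> (f z))"
    have "closed {x. F x = G x}"
      using F cont by (intro closed_Collect_eq) auto
    moreover have "range \<iota> \<subseteq> {x. F x = G x}" using F G(2) by auto
    ultimately have "closure (range \<iota>) \<subseteq> {x. F x = G x}" by (intro closure_minimal)
    then show "F = G" unfolding dense by blast
  qed
  then show "extend_cont \<iota> f (\<iota> z) = \<iota> (f z)"
    "dist (extend_cont \<iota> f x) (extend_cont \<iota> f y) \<le> R * dist x y"
    using G(2) lipschitz_onD[OF G(1)] by simp_all
qed

section \<open>Iterated function systems that contract on average\<close>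

lemma Cauchy_if_dist_le_summable:
  fixes x :: "nat \<Rightarrow> 'a::metric_space"
  assumes "summable b" "\<And>n. dist (x n) (x (Suc n)) \<le> b n"
  shows "Cauchy x"
proof (rule metric_CauchyI)
  define B where "B n = (\<Sum>k<n. b k)" for n
  have le: "dist (x m) (x n) \<le> B n - B m" if "m \<le> n" for m n
    using that
  proof (induction n rule: dec_induct)
    case (step n)
    have "dist (x m) (x (Suc n)) \<le> dist (x m) (x n) + dist (x n) (x (Suc n))"
      by (rule dist_triangle)
    also have "\<dots> \<le> (B n - B m) + b n"
      by (intro add_mono step.IH assms(2))
    finally show ?case by (simp add: B_def)
  qed simp
  fix e :: real assume "e > 0"
  have "Cauchy B"
    unfolding B_def using summable_LIMSEQ[OF assms(1)] by (rule LIMSEQ_imp_Cauchy)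
  then obtain N where N: "\<And>m n. m \<ge> N \<Longrightarrow> n \<ge> N \<Longrightarrow> dist (B m) (B n) < e"
    using metric_CauchyD[OF _ \<open>e > 0\<close>] by blast
  have "dist (x m) (x n) < e" if "m \<ge> N" "n \<ge> N" for m n
  proof (cases "m \<le> n")
    case True
    then show ?thesis using le[OF True] N[OF that] by (simp add: dist_real_def)
  next
    case False
    then have "dist (x n) (x m) \<le> B m - B n" by (intro le) simp
    then show ?thesis using N[OF that] by (simp add: dist_real_def dist_commute)
  qed
  then show "\<exists>M. \<forall>m\<ge>M. \<forall>n\<ge>M. dist (x m) (x n) < e" by blast
qed

text \<open>Points of divergence count as well. There \<open>lim\<close> is the constant
  \<open>THE x. False\<close>, and in a complete space convergence is the Cauchy property, which
  defines a measurable set.\<close>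

lemma borel_measurable_lim_polish:
  fixes f :: "nat \<Rightarrow> 'a \<Rightarrow> 'b::polish_space"
  assumes f [measurable]: "\<And>i. f i \<in> borel_measurable M"
  shows "(\<lambda>x. lim (\<lambda>i. f i x)) \<in> borel_measurable M"
proof -
  \<comment> \<open>Any constant will do: it replaces the divergent sequences, so that the modified
    functions converge everywhere.\<close>
  define c :: 'b where "c = undefined"
  define u where "u x = lim (\<lambda>i. if Cauchy (\<lambda>i. f i x) then f i x else c)" for x
  have *: "lim (\<lambda>i. f i x) = (if Cauchy (\<lambda>i. f i x) then u x else (THE x. False))" for x
    by (auto simp: u_def lim_def convergent_eq_Cauchy[symmetric])
  have "u \<in> borel_measurable M"
  proof (rule borel_measurable_LIMSEQ_metric)
    fix x
    have "convergent (\<lambda>i. if Cauchy (\<lambda>i. f i x) then f i x else c)"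
      by (cases "Cauchy (\<lambda>i. f i x)") (auto simp: Cauchy_convergent_iff convergent_const)
    then show "(\<lambda>i. if Cauchy (\<lambda>i. f i x) then f i x else c) \<longlonglongrightarrow> u x"
      unfolding u_def by (rule convergent_LIMSEQ_iff[THEN iffD1])
  qed measurable
  then show ?thesis
    unfolding * by measurable
qed

text \<open>The bound \<open>s \<le> 1\<close> is kept because \<open>AE_summable_prod\<close>
  dominates each term below 1 by its \<open>s\<close>-th power.\<close>

lemma exists_powr_sum_less:
  fixes R :: "nat \<Rightarrow> real"
  assumes "\<And>j. j < p \<Longrightarrow> 0 < R j" "(\<Prod>j<p. R j) < 1"
  shows "\<exists>s. 0 < s \<and> s \<le> 1 \<and> (\<Sum>j<p. R j powr s) < real p"
proof -
  have nz: "R j \<noteq> 0" if "j < p" for j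
    using assms(1)[OF that] by simp
  have "((\<lambda>s. \<Sum>j<p. R j powr s) has_real_derivative (\<Sum>j<p. R j powr 0 * ln (R j))) (at 0)"
    using assms(1) by (intro DERIV_sum) (auto intro!: derivative_eq_intros)
  also have "(\<Sum>j<p. R j powr 0 * ln (R j)) = ln (\<Prod>j<p. R j)"
    using nz by (subst ln_prod) (auto intro!: sum.cong)
  finally have deriv: "((\<lambda>s. \<Sum>j<p. R j powr s) has_real_derivative ln (\<Prod>j<p. R j)) (at 0)" .
  have neg: "ln (\<Prod>j<p. R j) < 0"
    using assms by (subst ln_less_zero_iff) (auto intro!: prod_pos)
  from DERIV_neg_dec_right[OF deriv neg] obtain d where d: "d > 0"
    "\<forall>s>0. s < d \<longrightarrow> (\<Sum>j<p. R j powr (0 + s)) < (\<Sum>j<p. R j powr 0)" by blast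
  have "(\<Sum>j<p. R j powr 0) = (\<Sum>j<p. 1)"
    using nz by (intro sum.cong) auto
  then show ?thesis
    using d(1) d(2)[rule_format, of "min (d / 2) 1"] by (intro exI[of _ "min (d / 2) 1"]) auto
qed

text \<open>Only the geometric mean of the Lipschitz constants is below 1, and single maps may
  expand. Strict positivity of \<open>R j\<close> gives access to logarithms in
  \<open>exists_powr_sum_less\<close>.\<close>

locale contractive_ifs =
  fixes p :: nat and h :: "nat \<Rightarrow> 'l \<Rightarrow> 'l::polish_space" and R :: "nat \<Rightarrow> real"
  assumes p_pos: "0 < p"
    and R_pos: "j < p \<Longrightarrow> 0 < R j"
    and prod_R: "(\<Prod>j<p. R j) < 1"
    and lipschitz: "j < p \<Longrightarrow> dist (h j x) (h j y) \<le> R j * dist x y"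
begin

abbreviation U :: "nat measure" where "U \<equiv> uniform_count_measure {..<p}"
abbreviation digits :: "(nat \<Rightarrow> nat) measure" where "digits \<equiv> PiM UNIV (\<lambda>_. U)"

lemma prob_space_U: "prob_space U"
  using p_pos by (intro prob_space_uniform_count_measure) auto

sublocale D: sequence_space U
  unfolding sequence_space_def by (intro product_prob_spaceI prob_space_U)

sublocale UD: pair_sigma_finite U digits
  using D.sigma_finite_measure_axioms prob_space_imp_sigma_finite[OF prob_space_U]
  by (simp add: pair_sigma_finite_def)

lemma digits_less: "d \<in> space digits \<Longrightarrow> d i < p"
  by (auto simp: space_PiM space_uniform_count_measure)

lemma sets_U: "sets U = sets (count_space {..<p})"
  by (simp add: sets_uniform_count_measure)

lemma measurable_case_nat_digits [measurable]:
  "(\<lambda>(j, d). case_nat j d) \<in> measurable (U \<Otimes>\<^sub>M digits) digits"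
  by measurable

lemma measurable_case_nat_digits' [measurable]:
  "j < p \<Longrightarrow> case_nat j \<in> measurable digits digits"
  using measurable_Pair2[OF measurable_case_nat_digits, of j]
  by (simp add: space_uniform_count_measure)

lemma measurable_digit [measurable]: "(\<lambda>d. d i) \<in> measurable digits (count_space {..<p})"
proof -
  have "(\<lambda>d. d i) \<in> measurable digits U"
    by (rule measurable_component_singleton) simp
  also have "\<dots> = measurable digits (count_space {..<p})"
    by (rule measurable_cong_sets) (simp_all add: sets_U)
  finally show ?thesis .
qed

lemma measurable_tail [measurable]: "(\<lambda>d i. d (Suc i)) \<in> measurable digits digits"
proof (rule measurable_PiM_single')
  show "(\<lambda>d. d (Suc i)) \<in> measurable digits U" for i
    by (rule measurable_component_singleton) simp
qed (auto simp: space_PiM)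

text \<open>Prepending a uniform digit to an independent digit sequence reproduces the law
  \<open>digits\<close>, and Fubini's theorem over the finite first factor gives the average. This
  invariance is the source of all self-similarity below.\<close>

lemma nn_integral_digits:
  assumes [measurable]: "f \<in> borel_measurable digits"
  shows "(\<integral>\<^sup>+ d. f d \<partial>digits) = (\<Sum>j<p. \<integral>\<^sup>+ d. f (case_nat j d) \<partial>digits) / of_nat p"
proof -
  have "(\<integral>\<^sup>+ d. f d \<partial>digits) = (\<integral>\<^sup>+ d. f d \<partial>distr (U \<Otimes>\<^sub>M digits) digits (\<lambda>(j, d). case_nat j d))"
    unfolding D.PiM_iter ..
  also have "\<dots> = (\<integral>\<^sup>+ z. f (case z of (j, d) \<Rightarrow> case_nat j d) \<partial>(U \<Otimes>\<^sub>M digits))"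
    by (subst nn_integral_distr) measurable
  also have "\<dots> = (\<integral>\<^sup>+ j. \<integral>\<^sup>+ d. f (case_nat j d) \<partial>digits \<partial>U)"
    by (subst D.nn_integral_fst[symmetric]) (auto intro!: measurable_compose[OF measurable_case_nat_digits])
  also have "\<dots> = (\<Sum>j<p. ennreal (1 / real p) * (\<integral>\<^sup>+ d. f (case_nat j d) \<partial>digits))"
    unfolding uniform_count_measure_def[of "{..<p}"]
    by (subst nn_integral_point_measure_finite) simp_all
  also have "\<dots> = ennreal (1 / real p) * (\<Sum>j<p. \<integral>\<^sup>+ d. f (case_nat j d) \<partial>digits)"
    by (simp add: sum_distrib_left)
  also have "ennreal (1 / real p) = inverse (of_nat p)"
    using p_pos by (simp add: inverse_ennreal inverse_eq_divide ennreal_of_nat_eq_real_of_nat)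
  finally show ?thesis
    by (simp add: divide_ennreal_def mult.commute)
qed

lemma integral_digits:
  fixes f :: "_ \<Rightarrow> 'b::{banach,second_countable_topology}"
  assumes "integrable digits f"
  shows "\<And>j. j < p \<Longrightarrow> integrable digits (\<lambda>d. f (case_nat j d))"
    and "(LINT d|digits. f d) = (\<Sum>j<p. LINT d|digits. f (case_nat j d)) /\<^sub>R real p"
proof -
  have [measurable]: "f \<in> borel_measurable digits" using assms by simp
  have int: "integrable (U \<Otimes>\<^sub>M digits) (\<lambda>z. f (case z of (j, d) \<Rightarrow> case_nat j d))"
    using assms by (subst (asm) D.PiM_iter[symmetric], subst (asm) integrable_distr_eq) simp_all
  \<comment> \<open>Fubini's theorem gives integrable slices for almost every digit only, but
    \<open>U\<close> charges every \<open>j < p\<close>.\<close>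
  have "AE j in U. integrable digits (\<lambda>d. f (case_nat j d))"
    using UD.AE_integrable_fst'[OF int] by simp
  then show *: "\<And>j. j < p \<Longrightarrow> integrable digits (\<lambda>d. f (case_nat j d))"
    using p_pos unfolding uniform_count_measure_def[of "{..<p}"] AE_point_measure by simp
  have "(LINT d|digits. f d) = integral\<^sup>L (distr (U \<Otimes>\<^sub>M digits) digits (\<lambda>(j, d). case_nat j d)) f"
    unfolding D.PiM_iter ..
  also have "\<dots> = (LINT z|(U \<Otimes>\<^sub>M digits). f (case z of (j, d) \<Rightarrow> case_nat j d))"
    by (rule integral_distr) simp_all
  also have "\<dots> = (LINT j|U. LINT d|digits. f (case_nat j d))"
    using UD.integral_fst'[OF int] by simp
  also have "\<dots> = (\<Sum>j<p. (1 / real p) *\<^sub>R (LINT d|digits. f (case_nat j d)))"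
    unfolding uniform_count_measure_def[of "{..<p}"]
    by (subst lebesgue_integral_point_measure_finite) simp_all
  finally show "(LINT d|digits. f d) = (\<Sum>j<p. LINT d|digits. f (case_nat j d)) /\<^sub>R real p"
    by (simp add: scaleR_sum_right inverse_eq_divide)
qed

text \<open>The digit \<open>d 0\<close> acts last, so a further digit enters at the innermost
  place. With this order the iterates converge pointwise for almost every \<open>d\<close>, and not
  merely in law.\<close>

primrec iter :: "nat \<Rightarrow> (nat \<Rightarrow> nat) \<Rightarrow> 'l \<Rightarrow> 'l" where
  "iter 0 d y = y"
| "iter (Suc n) d y = h (d 0) (iter n (\<lambda>i. d (Suc i)) y)"

text \<open>Writes consecutive iterates as the same composition at two different points, so that
  \<open>dist_iter\<close> bounds their distance.\<close>

lemma iter_Suc_right: "iter (Suc n) d y = iter n d (h (d n) y)"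
proof (induction n arbitrary: d)
  case (Suc n)
  show ?case unfolding iter.simps(2)[of "Suc n"] Suc.IH by simp
qed simp

lemma continuous_h: "j < p \<Longrightarrow> continuous_on UNIV (h j)"
  using lipschitz R_pos by (intro lipschitz_on_continuous_on[of "R j"] lipschitz_onI) (auto simp: less_imp_le)

lemma measurable_h [measurable]: "j < p \<Longrightarrow> h j \<in> borel_measurable borel"
  by (intro borel_measurable_continuous_onI continuous_h)

lemma dist_iter:
  assumes "\<And>i. d i < p"
  shows "dist (iter n d x) (iter n d y) \<le> (\<Prod>i<n. R (d i)) * dist x y"
  using assms
proof (induction n arbitrary: d)
  case (Suc n)
  have "dist (iter (Suc n) d x) (iter (Suc n) d y)
      \<le> R (d 0) * dist (iter n (\<lambda>i. d (Suc i)) x) (iter n (\<lambda>i. d (Suc i)) y)"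
    using lipschitz Suc.prems by simp
  also have "\<dots> \<le> R (d 0) * ((\<Prod>i<n. R (d (Suc i))) * dist x y)"
    using Suc R_pos[of "d 0"] by (intro mult_left_mono) (auto simp: less_imp_le)
  finally show ?case
    by (simp only: prod.lessThan_Suc_shift mult.assoc o_def)
qed simp

lemma measurable_iter [measurable]:
  "(\<lambda>z. iter n (fst z) (snd z)) \<in> measurable (digits \<Otimes>\<^sub>M borel) borel"
proof (induction n)
  case (Suc n)
  have "(\<lambda>z. (\<lambda>i. fst z (Suc i), snd z)) \<in> measurable (digits \<Otimes>\<^sub>M borel) (digits \<Otimes>\<^sub>M borel)"
    by (intro measurable_Pair measurable_compose[OF measurable_fst measurable_tail] measurable_snd)
  from measurable_compose[OF this Suc]
  have [measurable]: "(\<lambda>z. iter n (\<lambda>i. fst z (Suc i)) (snd z)) \<in> measurable (digits \<Otimes>\<^sub>M borel) borel"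
    by simp
  have "(\<lambda>z. h (fst z 0) (iter n (\<lambda>i. fst z (Suc i)) (snd z))) \<in> measurable (digits \<Otimes>\<^sub>M borel) borel"
    by (rule measurable_compose_countable'[where I = "{..<p}" and g = "\<lambda>z. fst z 0"])
      (auto intro!: measurable_compose[OF measurable_fst measurable_digit] measurable_compose[OF _ measurable_h])
  then show ?case by simp
qed simp

lemma measurable_iter_fixed [measurable]: "(\<lambda>d. iter n d y) \<in> borel_measurable digits"
proof -
  have "(\<lambda>d. (d, y)) \<in> measurable digits (digits \<Otimes>\<^sub>M borel)"
    by (rule measurable_Pair2') simp
  from measurable_compose[OF this measurable_iter[of n]] show ?thesis by simp
qed

lemma nn_integral_prod_digits:
  fixes g :: "nat \<Rightarrow> ennreal"
  shows "(\<integral>\<^sup>+ d. (\<Prod>i<n. g (d i)) \<partial>digits) = ((\<Sum>j<p. g j) / of_nat p) ^ n"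
proof (induction n)
  case 0
  then show ?case using D.emeasure_space_1 by simp
next
  case (Suc n)
  have [measurable]: "(\<lambda>d. g (d i)) \<in> borel_measurable digits" for i
    by (rule measurable_compose[OF measurable_digit]) simp
  have "(\<integral>\<^sup>+ d. (\<Prod>i<Suc n. g (d i)) \<partial>digits)
      = (\<Sum>j<p. \<integral>\<^sup>+ d. (\<Prod>i<Suc n. g (case_nat j d i)) \<partial>digits) / of_nat p"
    by (rule nn_integral_digits) measurable
  also have "\<dots> = (\<Sum>j<p. g j * (\<integral>\<^sup>+ d. (\<Prod>i<n. g (d i)) \<partial>digits)) / of_nat p"
    by (simp add: prod.lessThan_Suc_shift nn_integral_cmult del: prod.lessThan_Suc)
  also have "\<dots> = ((\<Sum>j<p. g j) / of_nat p) ^ Suc n"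
    unfolding Suc by (simp add: sum_distrib_right[symmetric] divide_ennreal_def mult_ac)
  finally show ?case .
qed

text \<open>
  A fractional moment \<open>\<Sum>\<^sub>j R\<^sub>j\<^sup>s\<close> with small \<open>s > 0\<close> is less than \<open>p\<close>, because its derivative
  at \<open>s = 0\<close> is the logarithm of \<open>\<Prod>\<^sub>j R\<^sub>j\<close>. This replaces the law of large numbers.
\<close>
lemma AE_summable_prod: "AE d in digits. summable (\<lambda>n. \<Prod>i<n. R (d i))"
proof -
  obtain s where s: "0 < s" "s \<le> 1" "(\<Sum>j<p. R j powr s) < real p"
    using exists_powr_sum_less[OF R_pos prod_R] by blast
  define x where "x = (\<Sum>j<p. R j powr s) / real p"
  have x: "0 \<le> x" "x < 1"
    using s p_pos by (auto simp: x_def intro!: divide_nonneg_nonneg sum_nonneg)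
  let ?g = "\<lambda>j. ennreal (R j powr s)"
  have [measurable]: "(\<lambda>d. ?g (d i)) \<in> borel_measurable digits" for i
    by (rule measurable_compose[OF measurable_digit]) simp
  have g: "(\<Sum>j<p. ?g j) / of_nat p = ennreal x"
    using p_pos by (simp add: sum_ennreal x_def ennreal_of_nat_eq_real_of_nat divide_ennreal sum_nonneg)
  have "(\<integral>\<^sup>+ d. (\<Sum>n. \<Prod>i<n. ?g (d i)) \<partial>digits) = (\<Sum>n. \<integral>\<^sup>+ d. (\<Prod>i<n. ?g (d i)) \<partial>digits)"
    by (rule nn_integral_suminf) measurable
  also have "\<dots> = (\<Sum>n. ennreal (x ^ n))"
    unfolding nn_integral_prod_digits[where g = ?g] g using x by (simp add: ennreal_power)
  also have "\<dots> = ennreal (\<Sum>n. x ^ n)"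
    using x by (intro suminf_ennreal2 summable_geometric) auto
  finally have "AE d in digits. (\<Sum>n. \<Prod>i<n. ?g (d i)) \<noteq> \<infinity>"
    by (intro nn_integral_PInf_AE) simp_all
  with AE_space show ?thesis
  proof eventually_elim
    case (elim d)
    define a where "a n = (\<Prod>i<n. R (d i))" for n
    have Rd: "0 < R (d i)" for i
      using R_pos digits_less[OF elim(1)] by blast
    have a: "0 < a n" for n
      unfolding a_def using Rd by (intro prod_pos) auto
    have "(\<Prod>i<n. ?g (d i)) = ennreal (a n powr s)" for n
      unfolding a_def using Rd by (subst prod_powr_distrib) (auto simp: prod_ennreal less_imp_le)
    then have "summable (\<lambda>n. a n powr s)"
      using elim(2) by (intro summable_suminf_not_top) simp_all
    note sum = this
    from summable_LIMSEQ_zero[OF this]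
    have "eventually (\<lambda>n. a n powr s < 1) sequentially"
      by (rule order_tendstoD) simp
    \<comment> \<open>The series of \<open>s\<close>-th powers converges, so its terms are
      eventually below 1; there \<open>s \<le> 1\<close> gives \<open>a n \<le> a n powr s\<close>,
      and \<open>a\<close> is summable by comparison.\<close>
    then have "eventually (\<lambda>n. norm (a n) \<le> a n powr s) sequentially"
    proof eventually_elim
      case (elim n)
      have "a n < 1"
      proof (rule ccontr)
        assume "\<not> ?thesis"
        then have "1 \<le> a n powr s" using s(1) by (intro ge_one_powr_ge_zero) auto
        then show False using elim by simp
      qed
      then have "a n powr 1 \<le> a n powr s"
        using s a[of n] by (intro powr_mono') auto
      then show ?case using a[of n] by simp
    qed
    then have "summable a"
      by (rule summable_comparison_test_ev[OF _ sum])
    then show ?case by (simp add: a_def[abs_def])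
  qed
qed

definition code_limit :: "'l \<Rightarrow> (nat \<Rightarrow> nat) \<Rightarrow> 'l" where
  "code_limit y0 d = lim (\<lambda>n. iter n d y0)"

lemma measurable_code_limit [measurable]: "code_limit y0 \<in> borel_measurable digits"
  unfolding code_limit_def[abs_def] by (intro borel_measurable_lim_polish measurable_iter_fixed)

text \<open>The quantifier over \<open>y\<close> stands inside: one null set serves all start
  points, since it depends only on the summability of the contraction factors. This permits
  integration over a random start point in \<open>stationary_le_open\<close>.\<close>

lemma AE_iter_tendsto: "AE d in digits. \<forall>y. (\<lambda>n. iter n d y) \<longlonglongrightarrow> code_limit y0 d"
  using AE_summable_prod AE_space
proof eventually_elim
  case (elim d)
  define a where "a n = (\<Prod>i<n. R (d i))" for n
  note d = digits_less[OF elim(2)]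
  have sum: "summable a" using elim(1) by (simp add: a_def[abs_def])
  have a: "0 \<le> a n" for n
    unfolding a_def using R_pos d by (intro prod_nonneg) (auto simp: less_imp_le)
  \<comment> \<open>There are finitely many branches, so one constant bounds the displacement of
    \<open>y0\<close> under the next branch, whatever its digit.\<close>
  define D where "D = (\<Sum>j<p. dist y0 (h j y0))"
  have "dist (iter n d y0) (iter (Suc n) d y0) \<le> a n * D" for n
  proof -
    have "dist (iter n d y0) (iter (Suc n) d y0) \<le> a n * dist y0 (h (d n) y0)"
      unfolding iter_Suc_right a_def by (rule dist_iter[OF d])
    also have "dist y0 (h (d n) y0) \<le> D"
      unfolding D_def using d by (intro member_le_sum) auto
    finally show ?thesis using a by (simp add: mult_left_mono)
  qed
  then have "Cauchy (\<lambda>n. iter n d y0)"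
    by (rule Cauchy_if_dist_le_summable[OF summable_mult2[OF sum]])
  then have lim: "(\<lambda>n. iter n d y0) \<longlonglongrightarrow> code_limit y0 d"
    unfolding code_limit_def by (simp add: Cauchy_convergent_iff convergent_LIMSEQ_iff)
  show ?case
  proof
    fix y
    have "(\<lambda>n. a n * dist y y0) \<longlonglongrightarrow> 0 * dist y y0"
      by (intro tendsto_mult summable_LIMSEQ_zero[OF sum] tendsto_const)
    moreover have "(\<lambda>n. dist (iter n d y0) (code_limit y0 d)) \<longlonglongrightarrow> 0"
      by (rule tendsto_dist_iff[THEN iffD1, OF lim])
    ultimately have bound: "(\<lambda>n. a n * dist y y0 + dist (iter n d y0) (code_limit y0 d)) \<longlonglongrightarrow> 0"
      using tendsto_add by fastforce
    have "dist (iter n d y) (code_limit y0 d) \<le> a n * dist y y0 + dist (iter n d y0) (code_limit y0 d)" for n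
    proof -
      have "dist (iter n d y) (iter n d y0) \<le> a n * dist y y0"
        unfolding a_def by (rule dist_iter[OF d])
      then show ?thesis
        using dist_triangle[of "iter n d y" "code_limit y0 d" "iter n d y0"] by linarith
    qed
    then have "(\<lambda>n. dist (iter n d y) (code_limit y0 d)) \<longlonglongrightarrow> 0"
      by (intro Lim_null_comparison[OF always_eventually bound]) simp
    then show "(\<lambda>n. iter n d y) \<longlonglongrightarrow> code_limit y0 d"
      by (rule tendsto_dist_iff[THEN iffD2])
  qed
qed

text \<open>Convergence is used for the tail \<open>d\<close> alone. The iterates of the prepended
  sequence are, from index 1 on, the images under \<open>h j\<close> of those of \<open>d\<close>,
  so they converge by continuity.\<close>

lemma AE_code_limit_case_nat:
  "AE d in digits. \<forall>j<p. code_limit y0 (case_nat j d) = h j (code_limit y0 d)"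
  using AE_iter_tendsto[of y0]
proof eventually_elim
  case (elim d)
  show ?case
  proof safe
    fix j assume "j < p"
    have "(\<lambda>n. h j (iter n d y0)) \<longlonglongrightarrow> h j (code_limit y0 d)"
      using continuous_on_tendsto_compose[OF continuous_h[OF \<open>j < p\<close>]] elim by auto
    then have "(\<lambda>n. iter (Suc n) (case_nat j d) y0) \<longlonglongrightarrow> h j (code_limit y0 d)"
      by simp
    then have "(\<lambda>n. iter n (case_nat j d) y0) \<longlonglongrightarrow> h j (code_limit y0 d)"
      by (rule LIMSEQ_imp_Suc)
    then show "code_limit y0 (case_nat j d) = h j (code_limit y0 d)"
      unfolding code_limit_def by (rule limI)
  qed
qed

section \<open>The stationary law and its uniqueness\<close>

definition stationary :: "'l \<Rightarrow> 'l measure" where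
  "stationary y0 = distr digits borel (code_limit y0)"

lemma borel_prob_stationary: "borel_prob (stationary y0)"
  unfolding borel_prob_def stationary_def by (simp add: D.prob_space_distr)

lemma self_similar_stationary: "self_similar p h (stationary y0)"
  unfolding self_similar_def
proof
  fix A :: "'l set" assume A [measurable]: "A \<in> sets borel"
  let ?Z = "code_limit y0"
  have "emeasure (stationary y0) A = (\<integral>\<^sup>+ d. indicator A (?Z d) \<partial>digits)"
    unfolding stationary_def
    by (subst nn_integral_indicator[symmetric], simp, subst nn_integral_distr) simp_all
  also have "\<dots> = (\<Sum>j<p. \<integral>\<^sup>+ d. indicator A (?Z (case_nat j d)) \<partial>digits) / of_nat p"
    by (rule nn_integral_digits) measurable
  also have "(\<Sum>j<p. \<integral>\<^sup>+ d. indicator A (?Z (case_nat j d)) \<partial>digits)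
      = (\<Sum>j<p. emeasure (distr (stationary y0) borel (h j)) A)"
  proof (rule sum.cong[OF refl])
    fix j assume "j \<in> {..<p}"
    then have j [measurable]: "h j \<in> borel_measurable borel" and "j < p" by simp_all
    have "(\<integral>\<^sup>+ d. indicator A (?Z (case_nat j d)) \<partial>digits) = (\<integral>\<^sup>+ d. indicator A (h j (?Z d)) \<partial>digits)"
      using AE_code_limit_case_nat[of y0] \<open>j < p\<close> by (intro nn_integral_cong_AE) (auto elim!: eventually_mono)
    also have "\<dots> = (\<integral>\<^sup>+ z. indicator A z \<partial>distr (stationary y0) borel (h j))"
      unfolding stationary_def
      by (subst nn_integral_distr, simp, simp, subst nn_integral_distr) simp_all
    finally show "(\<integral>\<^sup>+ d. indicator A (?Z (case_nat j d)) \<partial>digits) =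
        emeasure (distr (stationary y0) borel (h j)) A"
      by simp
  qed
  finally show "emeasure (stationary y0) A =
      (\<Sum>j<p. emeasure (distr (stationary y0) borel (h j)) A) / of_nat p" .
qed

text \<open>The detour through the digits yields integrability of every \<open>f (h j z)\<close>
  together with the identity, both from \<open>integral_digits\<close>.\<close>

lemma integral_stationary:
  fixes f :: "'l \<Rightarrow> 'b::{banach,second_countable_topology}"
  assumes "integrable (stationary y0) f"
  shows "\<And>j. j < p \<Longrightarrow> integrable (stationary y0) (\<lambda>z. f (h j z))"
    and "(LINT z|stationary y0. f z) = (\<Sum>j<p. LINT z|stationary y0. f (h j z)) /\<^sub>R real p"
proof -
  have [measurable]: "f \<in> borel_measurable borel"
    using borel_measurable_integrable[OF assms] by (simp add: stationary_def)
  have int: "integrable digits (\<lambda>d. f (code_limit y0 d))"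
    using assms unfolding stationary_def by (subst (asm) integrable_distr_eq) simp_all
  have AE: "AE d in digits. f (code_limit y0 (case_nat j d)) = f (h j (code_limit y0 d))" if "j < p" for j
    using AE_code_limit_case_nat[of y0] that by (auto elim!: eventually_mono)
  have meas: "(\<lambda>d. f (code_limit y0 (case_nat j d))) \<in> borel_measurable digits"
    "(\<lambda>d. f (h j (code_limit y0 d))) \<in> borel_measurable digits" if "j < p" for j
    using that by (intro measurable_compose[OF measurable_case_nat_digits'] measurable_compose[OF measurable_code_limit]
        measurable_compose[OF measurable_h]; simp)+
  show "integrable (stationary y0) (\<lambda>z. f (h j z))" if "j < p" for j
  proof -
    have "integrable digits (\<lambda>d. f (h j (code_limit y0 d)))"
      using integral_digits(1)[OF int that] by (rule integrable_cong_AE_imp) (use AE that in \<open>auto elim!: eventually_mono\<close>)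
    then show ?thesis
      unfolding stationary_def using that by (subst integrable_distr_eq) simp_all
  qed
  have "(LINT d|digits. f (code_limit y0 (case_nat j d))) = (LINT z|stationary y0. f (h j z))" if "j < p" for j
  proof -
    have [measurable]: "h j \<in> borel_measurable borel" using that by simp
    have "(LINT z|stationary y0. f (h j z)) = (LINT d|digits. f (h j (code_limit y0 d)))"
      unfolding stationary_def by (rule integral_distr) measurable
    moreover have "(LINT d|digits. f (code_limit y0 (case_nat j d))) = (LINT d|digits. f (h j (code_limit y0 d)))"
      by (rule integral_cong_AE[OF meas[OF that] AE[OF that]])
    ultimately show ?thesis by simp
  qed
  then have "(\<Sum>j<p. LINT d|digits. f (code_limit y0 (case_nat j d))) = (\<Sum>j<p. LINT z|stationary y0. f (h j z))"
    by (intro sum.cong) simp_all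
  moreover have "(LINT z|stationary y0. f z) = (LINT d|digits. f (code_limit y0 d))"
    unfolding stationary_def by (rule integral_distr) simp_all
  ultimately show "(LINT z|stationary y0. f z) = (\<Sum>j<p. LINT z|stationary y0. f (h j z)) /\<^sub>R real p"
    using integral_digits(2)[OF int] by simp
qed

text \<open>One random branch preserves \<nu>, hence so do \<open>n\<close> independent ones.
  Removing the outermost branch replaces \<open>A\<close> by its preimage, which is why
  \<open>A\<close> is general in the induction.\<close>

lemma self_similar_iter:
  assumes \<nu>: "borel_prob \<nu>" "self_similar p h \<nu>" and "A \<in> sets borel"
  shows "emeasure \<nu> A = (\<integral>\<^sup>+ d. \<integral>\<^sup>+ y. indicator A (iter n d y) \<partial>\<nu> \<partial>digits)"
  using assms(3)
proof (induction n arbitrary: A)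
  have sets [measurable_cong]: "sets \<nu> = sets borel" and prob: "prob_space \<nu>"
    using \<nu>(1) by (auto simp: borel_prob_def)
  interpret prob_space \<nu> by fact
  {
    case 0
    then show ?case
      using D.emeasure_space_1 by simp
  next
    case (Suc n)
    note [measurable] = Suc.prems
    have m: "(\<lambda>d. \<integral>\<^sup>+ y. indicator A (iter m d y) \<partial>\<nu>) \<in> borel_measurable digits" for m
    proof -
      have "(\<lambda>z. indicator A (iter m (fst z) (snd z)) :: ennreal) \<in> borel_measurable (digits \<Otimes>\<^sub>M \<nu>)"
        by (subst measurable_cong_sets[OF sets_pair_measure_cong[OF refl sets] refl]) measurable
      from borel_measurable_nn_integral_fst[OF this] show ?thesis by simp
    qed
    have "(\<integral>\<^sup>+ d. \<integral>\<^sup>+ y. indicator A (iter (Suc n) d y) \<partial>\<nu> \<partial>digits)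
        = (\<Sum>j<p. \<integral>\<^sup>+ d. \<integral>\<^sup>+ y. indicator A (h j (iter n d y)) \<partial>\<nu> \<partial>digits) / of_nat p"
      by (subst nn_integral_digits[OF m]) simp
    also have "(\<Sum>j<p. \<integral>\<^sup>+ d. \<integral>\<^sup>+ y. indicator A (h j (iter n d y)) \<partial>\<nu> \<partial>digits)
        = (\<Sum>j<p. emeasure (distr \<nu> borel (h j)) A)"
    proof (rule sum.cong[OF refl])
      fix j assume "j \<in> {..<p}"
      then have j [measurable]: "h j \<in> borel_measurable borel" by simp
      have [measurable]: "h j -` A \<in> sets borel"
        using measurable_sets[OF j Suc.prems] by simp
      have "(\<integral>\<^sup>+ d. \<integral>\<^sup>+ y. indicator A (h j (iter n d y)) \<partial>\<nu> \<partial>digits)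
          = (\<integral>\<^sup>+ d. \<integral>\<^sup>+ y. indicator (h j -` A) (iter n d y) \<partial>\<nu> \<partial>digits)"
        by (simp add: indicator_vimage[unfolded o_def])
      also have "\<dots> = emeasure \<nu> (h j -` A)"
        by (rule Suc.IH[symmetric]) measurable
      also have "\<dots> = emeasure (distr \<nu> borel (h j)) A"
        by (subst emeasure_distr) (simp_all add: sets_eq_imp_space_eq[OF sets])
      finally show "(\<integral>\<^sup>+ d. \<integral>\<^sup>+ y. indicator A (h j (iter n d y)) \<partial>\<nu> \<partial>digits)
          = emeasure (distr \<nu> borel (h j)) A" .
    qed
    finally show ?case
      using \<nu>(2) Suc.prems by (simp add: self_similar_def)
  }
qed

text \<open>
  A self-similar \<open>\<nu>\<close> is the law of \<open>iter n d y\<close> for random \<open>d\<close> and \<open>y\<close>; as \<open>n \<rightarrow> \<infinity>\<close> the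
  dependence on \<open>y\<close> disappears, and Fatou's lemma gives one half of weak convergence.
\<close>
lemma stationary_le_open:
  assumes \<nu>: "borel_prob \<nu>" "self_similar p h \<nu>" and W: "open W"
  shows "emeasure (stationary y0) W \<le> emeasure \<nu> W"
proof -
  have sets [measurable_cong]: "sets \<nu> = sets borel" and prob: "prob_space \<nu>"
    using \<nu>(1) by (auto simp: borel_prob_def)
  interpret prob_space \<nu> by fact
  have [measurable]: "W \<in> sets borel" using W by simp
  have m: "(\<lambda>d. \<integral>\<^sup>+ y. indicator W (iter n d y) \<partial>\<nu>) \<in> borel_measurable digits" for n
  proof -
    have "(\<lambda>z. indicator W (iter n (fst z) (snd z)) :: ennreal) \<in> borel_measurable (digits \<Otimes>\<^sub>M \<nu>)"
      by (subst measurable_cong_sets[OF sets_pair_measure_cong[OF refl sets] refl]) measurable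
    from borel_measurable_nn_integral_fst[OF this] show ?thesis by simp
  qed
  have my: "(\<lambda>y. indicator W (iter n d y) :: ennreal) \<in> borel_measurable \<nu>" if d: "d \<in> space digits" for n d
  proof -
    have "(\<lambda>y. iter n d y) \<in> borel_measurable borel"
      using measurable_compose[OF measurable_Pair1'[OF d] measurable_iter[of n]] by simp
    then have "(\<lambda>y. iter n d y) \<in> borel_measurable \<nu>"
      using measurable_cong_sets[OF sets refl] by blast
    then show ?thesis by measurable
  qed
  have "AE d in digits. indicator W (code_limit y0 d)
      \<le> liminf (\<lambda>n. \<integral>\<^sup>+ y. indicator W (iter n d y) \<partial>\<nu>)"
    using AE_iter_tendsto[of y0] AE_space
  proof eventually_elim
    case (elim d)
    \<comment> \<open>Openness of \<open>W\<close> enters here: if the limit lies in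
      \<open>W\<close>, then so do almost all iterates.\<close>
    have "indicator W (code_limit y0 d) \<le> liminf (\<lambda>n. indicator W (iter n d y) :: ennreal)" for y
    proof (cases "code_limit y0 d \<in> W")
      case True
      then have "eventually (\<lambda>n. iter n d y \<in> W) sequentially"
        using elim(1) W topological_tendstoD by blast
      then have "1 \<le> liminf (\<lambda>n. indicator W (iter n d y) :: ennreal)"
        by (intro Liminf_bounded) (auto elim!: eventually_mono)
      with True show ?thesis by simp
    qed simp
    then have "(\<integral>\<^sup>+ y. indicator W (code_limit y0 d) \<partial>\<nu>)
        \<le> (\<integral>\<^sup>+ y. liminf (\<lambda>n. indicator W (iter n d y)) \<partial>\<nu>)"
      by (intro nn_integral_mono) auto
    \<comment> \<open>Fatou's lemma is applied twice, here for the start point under \<nu> and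
      afterwards for the digits.\<close>
    also have "\<dots> \<le> liminf (\<lambda>n. \<integral>\<^sup>+ y. indicator W (iter n d y) \<partial>\<nu>)"
      by (intro nn_integral_liminf my elim(2))
    finally show ?case by (simp add: emeasure_space_1)
  qed
  then have "(\<integral>\<^sup>+ d. indicator W (code_limit y0 d) \<partial>digits)
      \<le> (\<integral>\<^sup>+ d. liminf (\<lambda>n. \<integral>\<^sup>+ y. indicator W (iter n d y) \<partial>\<nu>) \<partial>digits)"
    by (rule nn_integral_mono_AE)
  also have "\<dots> \<le> liminf (\<lambda>n. \<integral>\<^sup>+ d. \<integral>\<^sup>+ y. indicator W (iter n d y) \<partial>\<nu> \<partial>digits)"
    by (intro nn_integral_liminf m)
  also have "\<dots> = emeasure \<nu> W"
    by (simp add: self_similar_iter[OF \<nu>, symmetric] Liminf_const)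
  finally show ?thesis
    unfolding stationary_def
    by (subst nn_integral_indicator[symmetric], simp, subst nn_integral_distr) simp_all
qed

text \<open>Both measures have mass 1, so the one-sided inequality for a Borel set and for its
  complement forces equality. Applied to another stationary law, this shows that
  \<open>stationary y0\<close> is the same for every \<open>y0\<close>.\<close>

lemma stationary_unique:
  assumes \<nu>: "borel_prob \<nu>" "self_similar p h \<nu>"
  shows "\<nu> = stationary y0"
proof (rule measure_eqI)
  let ?\<mu> = "stationary y0"
  have sets: "sets \<nu> = sets borel" "sets ?\<mu> = sets borel"
    using \<nu>(1) borel_prob_stationary by (auto simp: borel_prob_def)
  interpret N: prob_space \<nu> using \<nu>(1) by (simp add: borel_prob_def)
  interpret M: prob_space ?\<mu> using borel_prob_stationary by (simp add: borel_prob_def)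
  show "sets \<nu> = sets ?\<mu>" using sets by simp
  have le: "M.prob B \<le> N.prob B" if B: "B \<in> sets borel" for B
  proof -
    have "emeasure ?\<mu> B = (INF W\<in>{W. B \<subseteq> W \<and> open W}. emeasure ?\<mu> W)"
      by (rule outer_regular[OF sets(2) _ B]) simp
    also have "\<dots> \<le> (INF W\<in>{W. B \<subseteq> W \<and> open W}. emeasure \<nu> W)"
      using stationary_le_open[OF \<nu>] by (intro INF_mono) auto
    also have "\<dots> = emeasure \<nu> B"
      by (rule outer_regular[OF sets(1) _ B, symmetric]) simp
    finally show ?thesis
      by (simp add: N.emeasure_eq_measure M.emeasure_eq_measure)
  qed
  fix B assume "B \<in> sets \<nu>"
  then have B: "B \<in> sets borel" using sets by simp
  have sp: "space \<nu> = UNIV" "space ?\<mu> = UNIV"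
    using sets_eq_imp_space_eq[OF sets(1)] sets_eq_imp_space_eq[OF sets(2)] by simp_all
  have "M.prob (- B) = 1 - M.prob B" "N.prob (- B) = 1 - N.prob B"
    using M.prob_compl[of B] N.prob_compl[of B] B by (simp_all add: sets sp Compl_eq_Diff_UNIV)
  moreover have "- B \<in> sets borel" using B by auto
  ultimately have "N.prob B = M.prob B"
    using le[OF B] le[of "- B"] by simp
  then show "emeasure \<nu> B = emeasure ?\<mu> B"
    by (simp add: N.emeasure_eq_measure M.emeasure_eq_measure)
qed

end

section \<open>The Wiener algebra\<close>

text \<open>Local finiteness covers the space by open sets of finite mass, and by Lindelof's theorem
  countably many of them suffice.\<close>

lemma haar_measure_sigma_finite:
  fixes M :: "'l::{field,second_countable_topology} measure"
  assumes "haar_measure v M"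
  shows "sigma_finite_measure M"
proof
  have sets: "sets M = sets borel" using assms by (simp add: haar_measure_def)
  define \<U> where "\<U> = {U :: 'l set. open U \<and> emeasure M U < \<infinity>}"
  have "\<Union>\<U> = UNIV"
    using assms unfolding haar_measure_def \<U>_def by blast
  moreover obtain \<V> where "\<V> \<subseteq> \<U>" "countable \<V>" "\<Union>\<V> = \<Union>\<U>"
    by (rule Lindelof[of \<U>]) (auto simp: \<U>_def)
  ultimately have \<V>: "countable \<V>" "\<V> \<subseteq> \<U>" "\<Union>\<V> = UNIV" by simp_all
  have "\<V> \<subseteq> sets M" "\<forall>a\<in>\<V>. emeasure M a \<noteq> \<infinity>"
    using \<V>(2) unfolding \<U>_def sets by (blast intro: borel_open, fastforce)
  with \<V> show "\<exists>A. countable A \<and> A \<subseteq> sets M \<and> \<Union>A = space M \<and> (\<forall>a\<in>A. emeasure M a \<noteq> \<infinity>)"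
    unfolding sets_eq_imp_space_eq[OF sets] space_borel by blast
qed

text \<open>
  Fubini's theorem computes the integral of \<open>f\<close> from any function representing it, so
  uniqueness of the representing function is not needed.
\<close>
lemma represents_integral:
  fixes M \<mu> :: "'l::{field,second_countable_topology} measure"
  assumes M: "sigma_finite_measure M" "sets M = sets borel"
    and \<mu>: "borel_prob \<mu>"
    and e [measurable]: "e \<in> borel_measurable borel" and norm_e: "\<And>x. cmod (e x) = 1"
    and mult: "(\<lambda>z :: 'l \<times> 'l. fst z * snd z) \<in> borel_measurable (borel \<Otimes>\<^sub>M borel)"
    and f: "represents e M g f"
  shows "integrable \<mu> f"
    and "(LINT z|\<mu>. f z) = (LINT t|M. g t * (LINT z|\<mu>. e (t * z)))"
    and "cmod (LINT z|\<mu>. f z) \<le> (LINT w|M. cmod (g w))"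
proof -
  have sets_\<mu>: "sets \<mu> = sets borel" using \<mu> by (simp add: borel_prob_def)
  interpret prob_space \<mu> using \<mu> by (simp add: borel_prob_def)
  interpret M: sigma_finite_measure M by fact
  interpret P: pair_sigma_finite M \<mu> ..
  have g [measurable]: "integrable M g" and f_eq: "f = (\<lambda>z. LINT w|M. g w * e (w * z))"
    using f by (auto simp: represents_def)
  have sets_pair: "sets (M \<Otimes>\<^sub>M \<mu>) = sets (borel \<Otimes>\<^sub>M borel)"
    by (rule sets_pair_measure_cong[OF M(2) sets_\<mu>])
  have [measurable]: "(\<lambda>z. fst z * snd z) \<in> measurable (M \<Otimes>\<^sub>M \<mu>) borel"
    using mult measurable_cong_sets[OF sets_pair refl] by blast
  have e2: "(\<lambda>z. e (fst z * snd z)) \<in> borel_measurable (M \<Otimes>\<^sub>M \<mu>)"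
    by measurable
  have ge [measurable]: "(\<lambda>z. g (fst z) * e (fst z * snd z)) \<in> borel_measurable (M \<Otimes>\<^sub>M \<mu>)"
    using e2 by measurable
  have e_w: "(\<lambda>z. e (w * z)) \<in> borel_measurable \<mu>" for w
    using measurable_compose[OF measurable_Pair1'[of w M \<mu>] e2]
    by (simp add: sets_eq_imp_space_eq[OF M(2)])
  \<comment> \<open>As \<open>e\<close> has modulus 1 and \<mu> has mass 1, the integral of the
    modulus over both variables is that of \<open>cmod (g w)\<close>.\<close>
  have int: "integrable (M \<Otimes>\<^sub>M \<mu>) (\<lambda>(w, z). g w * e (w * z))"
  proof (rule P.Fubini_integrable)
    show "(\<lambda>(w, z). g w * e (w * z)) \<in> borel_measurable (M \<Otimes>\<^sub>M \<mu>)"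
      using ge by (simp add: case_prod_beta')
    show "integrable M (\<lambda>w. LINT z|\<mu>. norm (case (w, z) of (w, z) \<Rightarrow> g w * e (w * z)))"
      using integrable_norm[OF g] by (simp add: norm_mult norm_e prob_space)
    show "AE w in M. integrable \<mu> (\<lambda>z. case (w, z) of (w, z) \<Rightarrow> g w * e (w * z))"
      using e_w by (intro AE_I2) (auto intro!: integrable_const_bound[where B = "cmod (g _)"] simp: norm_mult norm_e)
  qed
  show int_f: "integrable \<mu> f"
    unfolding f_eq by (rule P.integrable_snd[OF int])
  show "(LINT z|\<mu>. f z) = (LINT t|M. g t * (LINT z|\<mu>. e (t * z)))"
    unfolding f_eq using P.Fubini_integral[OF int] by simp
  have "cmod (f z) \<le> (LINT w|M. cmod (g w))" for z
  proof -
    have "cmod (f z) \<le> (LINT w|M. cmod (g w * e (w * z)))"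
      unfolding f_eq by (rule integral_norm_bound)
    then show ?thesis by (simp add: norm_mult norm_e)
  qed
  then have "(LINT z|\<mu>. cmod (f z)) \<le> (LINT w|M. cmod (g w))"
    by (intro integral_le_const integrable_norm int_f) auto
  then show "cmod (LINT z|\<mu>. f z) \<le> (LINT w|M. cmod (g w))"
    using integral_norm_bound[of \<mu> f] by linarith
qed

text \<open>\<open>wiener_hat\<close> of a combination is a fresh choice, not tied to those for
  \<open>f\<close> and \<open>g\<close>. Linearity of the functional is therefore read off from
  integration against \<mu>, which applies once the combination is known to lie in the
  algebra.\<close>

lemma wiener_algebra_lincomb:
  fixes M :: "'l::{field,second_countable_topology} measure"
  assumes M: "sets M = sets borel"
    and e [measurable]: "e \<in> borel_measurable borel" and norm_e: "\<And>x. cmod (e x) = 1"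
    and mult: "(\<lambda>z :: 'l \<times> 'l. fst z * snd z) \<in> borel_measurable (borel \<Otimes>\<^sub>M borel)"
    and f: "f \<in> wiener_algebra e M" "g \<in> wiener_algebra e M"
  shows "(\<lambda>z. a * f z + b * g z) \<in> wiener_algebra e M"
proof -
  obtain f' g' where f': "represents e M f' f" and g': "represents e M g' g"
    using f by (auto simp: wiener_algebra_def)
  have e_z: "(\<lambda>w. e (w * z)) \<in> borel_measurable M" for z
  proof -
    have "(\<lambda>w. w * z) \<in> borel_measurable borel"
      using measurable_compose[OF measurable_Pair2'[of z borel borel] mult] by simp
    then have "(\<lambda>w. e (w * z)) \<in> borel_measurable borel" by measurable
    then show ?thesis using measurable_cong_sets[OF M refl] by blast
  qed
  have int: "integrable M (\<lambda>w. u w * e (w * z))" if "integrable M u" for u :: "'l \<Rightarrow> complex" and z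
    using that by (rule Bochner_Integration.integrable_bound)
      (use that e_z in \<open>auto simp: norm_mult norm_e\<close>)
  have "represents e M (\<lambda>w. a * f' w + b * g' w) (\<lambda>z. a * f z + b * g z)"
    using f' g' int by (auto simp: represents_def distrib_right mult.assoc)
  then show ?thesis
    by (auto simp: wiener_algebra_def)
qed

lemma represents_wiener_hat:
  assumes "f \<in> wiener_algebra e M"
  shows "represents e M (wiener_hat e M f) f"
proof -
  from assms have "\<exists>g. represents e M g f" unfolding wiener_algebra_def by (rule CollectD)
  then show ?thesis unfolding wiener_hat_def by (rule someI_ex)
qed

section \<open>The numen\<close>

text \<open>The coset of 1 differs from the proper ideal \<open>\<Lambda> = L 0\<close>, so its
  index is nonzero. This also excludes an infinite quotient, whose \<open>card\<close> would be
  0.\<close>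

lemma hydra_map_ge_2:
  assumes "hydra_map \<Lambda> p L r c H"
  shows "2 \<le> p"
proof -
  let ?R = "ring_of_integers :: 'a ring"
  have H: "ideal \<Lambda> ?R" "\<Lambda> \<noteq> carrier ?R" "bij_betw L {..<p} (carrier (?R Quot \<Lambda>))" "L 0 = \<Lambda>"
    using assms unfolding hydra_map_def by blast+
  note proper = H(2) and bij = H(3) and L0 = H(4)
  interpret ideal \<Lambda> ?R by (rule H(1))
  have one: "1 \<in> carrier ?R" using one_closed by (simp add: ring_of_integers_def)
  define C where "C = \<Lambda> +>\<^bsub>?R\<^esub> 1"
  have C: "C \<in> carrier (?R Quot \<Lambda>)"
    using one unfolding C_def FactRing_def A_RCOSETS_def' by auto
  have "0 \<in> \<Lambda>"
    using additive_subgroup.zero_closed[OF additive_subgroup_axioms] by (simp add: ring_of_integers_def)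
  then have "0 + 1 \<in> (\<Union>h\<in>\<Lambda>. {h + 1})" by blast
  moreover have "C = (\<Union>h\<in>\<Lambda>. {h + 1})"
    unfolding C_def a_r_coset_def' by (simp add: ring_of_integers_def)
  ultimately have "1 \<in> C" by simp
  moreover have "1 \<notin> \<Lambda>"
  proof
    assume "1 \<in> \<Lambda>"
    then have "one ?R \<in> \<Lambda>" by (simp add: ring_of_integers_def)
    then show False using one_imp_carrier proper by blast
  qed
  ultimately have "C \<noteq> \<Lambda>" by blast
  have "C \<in> L ` {..<p}"
    using bij C by (simp only: bij_betw_def)
  then obtain j where j: "j < p" "L j = C"
    by (elim imageE) simp
  with L0 \<open>C \<noteq> \<Lambda>\<close> have "j \<noteq> 0" by auto
  with j show ?thesis by simp
qed

text \<open>Witness for the existence of the numen. Since 0 is its own quotient by \<open>p\<close>,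
  the value there is passed in as \<open>x0\<close>, to be taken as the fixed point of branch 0. The
  guard \<open>p < 2\<close> secures termination.\<close>

function numen_rec :: "nat \<Rightarrow> 'k \<Rightarrow> (nat \<Rightarrow> 'k \<Rightarrow> 'k) \<Rightarrow> (nat \<Rightarrow> 'k::plus) \<Rightarrow> nat \<Rightarrow> 'k" where
  "numen_rec p x0 r c n = (if n = 0 \<or> p < 2 then x0
     else r (n mod p) (numen_rec p x0 r c (n div p)) + c (n mod p))"
  by pat_completeness auto
termination by (relation "Wellfounded.measure (\<lambda>(p, x0, r, c, n). n)") auto

declare numen_rec.simps [simp del]

text \<open>For \<open>n = 0\<close> and \<open>j = 0\<close> the recursion is the fixed point
  equation of branch 0, which properness solves uniquely; every other instance refers to a smaller
  argument.\<close>

lemma numen_eq: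
  assumes "2 \<le> p" "proper_hydra r" "j < p"
  shows "numen p r c (p * n + j) = r j (numen p r c n) + c j"
proof -
  have bij: "bij (\<lambda>z. z - r 0 z)" using assms(2) by (simp add: proper_hydra_def)
  have "\<exists>!X. \<forall>n. \<forall>j<p. X (p * n + j) = r j (X n) + c j"
  proof (rule ex_ex1I)
    obtain x0 where x0: "x0 - r 0 x0 = c 0"
      using bij by (metis bij_pointE)
    have "numen_rec p x0 r c (p * n + j) = r j (numen_rec p x0 r c n) + c j" if j: "j < p" for n j
    proof (cases "p * n + j = 0")
      case True
      then have "n = 0" "j = 0" using assms(1) by auto
      then show ?thesis
        using x0 by (simp add: numen_rec.simps[of _ _ _ _ 0] algebra_simps)
    next
      case False
      then show ?thesis
        using j assms(1) False by (subst numen_rec.simps) auto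
    qed
    then show "\<exists>X. \<forall>n. \<forall>j<p. X (p * n + j) = r j (X n) + c j" by blast
  next
    fix X Y assume X: "\<forall>n. \<forall>j<p. X (p * n + j) = r j (X n) + c j"
      and Y: "\<forall>n. \<forall>j<p. Y (p * n + j) = r j (Y n) + c j"
    have "X n = Y n" for n
    proof (induction n rule: less_induct)
      case (less n)
      show ?case
      proof (cases "n = 0")
        case True
        have "X 0 = r 0 (X 0) + c 0" "Y 0 = r 0 (Y 0) + c 0"
          using X[rule_format, of 0 0] Y[rule_format, of 0 0] assms(1) by simp_all
        then have "X 0 - r 0 (X 0) = Y 0 - r 0 (Y 0)"
          by (metis add_diff_cancel_left')
        then show ?thesis
          using injD[OF bij_is_inj[OF bij], of "X 0" "Y 0"] True by simp
      next
        case False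
        then have "n div p < n" using assms(1) by simp
        then have "X (n div p) = Y (n div p)" by (rule less)
        moreover have "n mod p < p" using assms(1) by simp
        ultimately show ?thesis
          using X[rule_format, of "n mod p" "n div p"] Y[rule_format, of "n mod p" "n div p"] by simp
      qed
    qed
    then show "X = Y" by blast
  qed
  from theI'[OF this, folded numen_def] show ?thesis
    using assms(3) by blast
qed

text \<open>Splitting off the lowest digit, not the highest, matches the form
  \<open>p * n + j\<close> in the recursion of the numen.\<close>

lemma padic_of_digits_Suc:
  "padic_of_digits p d (Suc n) = p * padic_of_digits p (\<lambda>i. d (Suc i)) n + d 0"
  unfolding padic_of_digits_def
  by (simp add: sum.lessThan_Suc_shift sum_distrib_left mult_ac del: sum.lessThan_Suc)

lemma measurable_numen_ext:
  fixes \<iota> :: "'k::field_char_0 \<Rightarrow> 'l::polish_space"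
  shows "numen_ext p \<iota> r c \<in> borel_measurable (sigma (padic_ints p) (padic_cosets p))"
  unfolding numen_ext_def[abs_def]
proof (rule borel_measurable_lim_polish)
  fix n
  let ?S = "sigma (padic_ints p) (padic_cosets p)"
  have space: "space ?S = padic_ints p"
    using padic_cosets_subset by (rule space_measure_of)
  have "(\<lambda>z. z n) \<in> measurable ?S (count_space UNIV)"
  proof (subst measurable_count_space_eq2_countable)
    \<comment> \<open>The fibres of the residue map are generating cosets. The case
      \<open>k \<ge> p ^ n\<close> is separate because \<open>padic_coset\<close> reduces
      \<open>k\<close> modulo \<open>p ^ n\<close>, while the fibre is empty.\<close>
    have "(\<lambda>z. z n) -` {k} \<inter> space ?S \<in> sets ?S" for k
    proof (cases "k < p ^ n")
      case True
      then have "(\<lambda>z. z n) -` {k} \<inter> space ?S = padic_coset p n k"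
        by (auto simp: space padic_coset_def)
      also have "\<dots> \<in> sets ?S"
        using padic_cosets_subset by (auto simp: sets_measure_of padic_cosets_def)
      finally show ?thesis .
    next
      case False
      then have "(\<lambda>z. z n) -` {k} \<inter> space ?S = {}"
        unfolding space by (auto simp: padic_ints_def)
      then show ?thesis by simp
    qed
    then show "(\<lambda>z. z n) \<in> space ?S \<rightarrow> UNIV \<and> (\<forall>k\<in>UNIV. (\<lambda>z. z n) -` {k} \<inter> space ?S \<in> sets ?S)"
      by simp
  qed
  then show "(\<lambda>z. \<iota> (numen p r c (z n))) \<in> borel_measurable ?S"
    by (rule measurable_compose) simp
qed

text \<open>At the integer with digits \<open>d 0\<close>, ..., \<open>d (n - 1)\<close> the
  embedded numen is exactly \<open>iter n d\<close> at the image of \<open>numen p r c 0\<close>.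
  Both sides are thus \<open>lim\<close> of the same sequence for every digit sequence, convergent
  or not.\<close>

lemma (in contractive_ifs) distr_numen_ext:
  fixes \<iota> :: "'k::field_char_0 \<Rightarrow> 'l"
  assumes "2 \<le> p" "proper_hydra r"
    and h: "\<And>j z. j < p \<Longrightarrow> h j (\<iota> z) = \<iota> (r j z + c j)"
  shows "distr (padic_haar p) borel (numen_ext p \<iota> r c) = stationary (\<iota> (numen p r c 0))"
proof -
  have iter: "\<iota> (numen p r c (padic_of_digits p d n)) = iter n d (\<iota> (numen p r c 0))"
    if "\<And>i. d i < p" for d n
    using that
  proof (induction n arbitrary: d)
    case 0
    then show ?case by (simp add: padic_of_digits_def)
  next
    case (Suc n)
    have "\<iota> (numen p r c (padic_of_digits p d (Suc n)))
        = h (d 0) (\<iota> (numen p r c (padic_of_digits p (\<lambda>i. d (Suc i)) n)))"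
      unfolding padic_of_digits_Suc using Suc.prems by (simp add: numen_eq assms h)
    then show ?case using Suc by simp
  qed
  have "distr (padic_haar p) borel (numen_ext p \<iota> r c)
      = distr digits borel (numen_ext p \<iota> r c \<circ> padic_of_digits p)"
    unfolding padic_haar_def
    by (rule distr_distr[OF measurable_numen_ext measurable_padic_of_digits(1)[OF p_pos]])
  also have "\<dots> = distr digits borel (code_limit (\<iota> (numen p r c 0)))"
    by (rule distr_cong[OF refl refl])
      (simp add: numen_ext_def code_limit_def iter digits_less)
  finally show ?thesis by (simp add: stationary_def)
qed

section \<open>Self-similarity of the law of the numen\<close>

text \<open>An infinite factor times a nonzero product of the others is infinite, so positivity of
  all factors makes each one finite.\<close>

lemma ennreal_prod_less_1D:
  fixes f :: "'i \<Rightarrow> ennreal"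
  assumes "finite I" "(\<Prod>i\<in>I. f i) < 1" "\<And>i. i \<in> I \<Longrightarrow> 0 < f i"
  shows "\<And>i. i \<in> I \<Longrightarrow> f i < \<infinity>" "(\<Prod>i\<in>I. enn2real (f i)) < 1"
proof -
  show fin: "f i < \<infinity>" if "i \<in> I" for i
  proof (rule ccontr)
    assume "\<not> ?thesis"
    then have "f i = \<infinity>" by (simp flip: less_top)
    moreover have "(\<Prod>i\<in>A. f i) \<noteq> 0" if "A \<subseteq> I" for A
      using that assms(3)
      by (induction A rule: infinite_finite_induct) (auto simp: less_le)
    from this[of "I - {i}"] have "(\<Prod>i\<in>I - {i}. f i) \<noteq> 0" by blast
    ultimately have "(\<Prod>i\<in>I. f i) = \<infinity>"
      using assms(1) that by (simp add: prod.remove ennreal_top_mult)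
    then show False using assms(2) by simp
  qed
  have "(\<Prod>i\<in>I. f i) = (\<Prod>i\<in>I. ennreal (enn2real (f i)))"
    using fin by (intro prod.cong refl) simp
  also have "\<dots> = ennreal (\<Prod>i\<in>I. enn2real (f i))"
    by (rule prod_ennreal) simp
  finally show "(\<Prod>i\<in>I. enn2real (f i)) < 1"
    using assms(2) by (simp add: ennreal_less_iff prod_nonneg flip: ennreal_1)
qed

text \<open>The image of a rational basis of the number field has a rational span that is dense in
  the completion. What remains is that \<open>\<iota>\<close>, given as a unital ring homomorphism,
  is injective and fixes the rationals.\<close>

lemma completion_exists_basis:
  fixes \<iota> :: "'k::field_char_0 \<Rightarrow> 'l::{field_char_0,polish_space}"
  assumes "number_field TYPE('k)" "completion_at w \<iota> v"
  shows "\<exists>B :: 'l set. basis_over base_field B"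
proof -
  have \<iota>: "\<iota> 1 = 1" "\<And>x y. \<iota> (x + y) = \<iota> x + \<iota> y" "\<And>x y. \<iota> (x * y) = \<iota> x * \<iota> y"
    and dense: "closure (range \<iota>) = UNIV"
    using assms(2) by (simp_all add: completion_at_def)
  interpret valued_metric_field v
    using assms(2) by unfold_locales (simp_all add: completion_at_def)
  have \<iota>0: "\<iota> 0 = 0" using \<iota>(2)[of 0 0] by simp
  have \<iota>_uminus: "\<iota> (- x) = - \<iota> x" for x
    using \<iota>(2)[of x "- x"] \<iota>0 by (simp add: eq_neg_iff_add_eq_0 add.commute)
  have \<iota>_nat: "\<iota> (of_nat n) = of_nat n" for n
    by (induction n) (simp_all add: \<iota> \<iota>0)
  have \<iota>_int: "\<iota> (of_int n) = of_int n" for n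
    by (cases n rule: int_cases2) (simp_all add: \<iota>_nat \<iota>_uminus)
  have \<iota>_rat: "\<iota> (of_rat q) = of_rat q" for q
  proof -
    obtain a b where q: "q = Fract a b" "b > 0" by (cases q)
    have "\<iota> (of_rat q) * of_int b = \<iota> (of_rat q * of_int b)" by (simp add: \<iota> \<iota>_int)
    also have "of_rat q * of_int b = (of_int a :: 'k)" using q by (simp add: of_rat_rat)
    also have "\<iota> (of_int a) = of_int a" by (rule \<iota>_int)
    finally show ?thesis using q by (simp add: of_rat_rat field_simps)
  qed
  have \<iota>_sum: "\<iota> (sum f A) = (\<Sum>a\<in>A. \<iota> (f a))" for f and A :: "'k set"
    by (induction A rule: infinite_finite_induct) (simp_all add: \<iota> \<iota>0)
  have inj: "inj \<iota>"
  proof (rule injI)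
    fix x y assume "\<iota> x = \<iota> y"
    then have "\<iota> (x - y) = 0"
      using \<iota>(2)[of x "- y"] \<iota>_uminus[of y] by simp
    moreover have "\<iota> (x - y) * \<iota> (inverse (x - y)) = 1" if "x \<noteq> y"
      unfolding \<iota>(3)[symmetric] using that \<iota>(1) by simp
    ultimately show "x = y" by auto
  qed
  obtain B where "finite_dimensional_vector_space (rat_scale :: rat \<Rightarrow> 'k \<Rightarrow> 'k) B"
    using assms(1) unfolding number_field_def by blast
  then interpret V: finite_dimensional_vector_space "rat_scale :: rat \<Rightarrow> 'k \<Rightarrow> 'k" B .
  show ?thesis
  proof (rule exists_basis_over_base_field[OF _ dense])
    show "finite (\<iota> ` B)" using V.finite_Basis by simp
    fix x assume "x \<in> range \<iota>"
    then obtain y where y: "x = \<iota> y" by blast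
    have "y \<in> V.span B" using V.span_Basis by simp
    then obtain u where u: "y = (\<Sum>b\<in>B. rat_scale (u b) b)"
      unfolding V.span_finite[OF V.finite_Basis] by blast
    have "x = (\<Sum>b\<in>B. of_rat (u b) * \<iota> b)"
      by (simp add: y u \<iota>_sum rat_scale_def \<iota>(3) \<iota>_rat)
    \<comment> \<open>Coefficients must become functions of the image vectors, which uses
      injectivity of \<open>\<iota>\<close>.\<close>
    also have "\<dots> = (\<Sum>s\<in>\<iota> ` B. of_rat (u (the_inv \<iota> s)) * s)"
      using inj by (subst sum.reindex) (auto simp: the_inv_f_f inj_on_def)
    finally show "\<exists>q. x = (\<Sum>s\<in>\<iota> ` B. of_rat (q s) * s)"
      by (rule exI[of _ "\<lambda>s. u (the_inv \<iota> s)"])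
  qed
qed

lemma completion_dist:
  assumes "completion_at w \<iota> v"
  shows "dist (\<iota> x) (\<iota> y) = w (x - y)"
proof -
  have add: "\<And>x y. \<iota> (x + y) = \<iota> x + \<iota> y" and dist: "\<And>x y. dist x y = v (x - y)"
    and v: "\<And>z. v (\<iota> z) = w z"
    using assms unfolding completion_at_def by blast+
  have "\<iota> x - \<iota> y = \<iota> (x - y)"
    using add[of "x - y" y] by simp
  then show ?thesis by (simp add: dist v)
qed

lemma branch_ext:
  fixes w :: "'k::field_char_0 \<Rightarrow> real" and \<iota> :: "'k \<Rightarrow> 'l::{field_char_0,polish_space}"
  assumes "number_field TYPE('k)" "absolute_value w" "nontrivial_abs w" "completion_at w \<iota> v"
    and r: "rat_linear (r j)" "op_norm w (r j) < \<infinity>"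
  shows "branch_ext \<iota> r c j (\<iota> z) = \<iota> (r j z + c j)"
    and "dist (branch_ext \<iota> r c j x) (branch_ext \<iota> r c j y) \<le> enn2real (op_norm w (r j)) * dist x y"
proof -
  have dense: "closure (range \<iota>) = UNIV"
    using assms(4) by (simp add: completion_at_def)
  have lip: "dist (\<iota> (r j z + c j)) (\<iota> (r j z' + c j)) \<le> enn2real (op_norm w (r j)) * dist (\<iota> z) (\<iota> z')"
    for z z'
    using op_norm_bound[OF assms(1-3) r, of "z - z'"]
    by (simp add: completion_dist[OF assms(4)] rat_linear_simps(4)[OF r(1)])
  show "branch_ext \<iota> r c j (\<iota> z) = \<iota> (r j z + c j)"
    "dist (branch_ext \<iota> r c j x) (branch_ext \<iota> r c j y) \<le> enn2real (op_norm w (r j)) * dist x y"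
    unfolding branch_ext_def
    by (rule extend_cont_lipschitz[OF dense enn2real_nonneg lip])+
qed

theorem proposition7p3:
  fixes w :: "'k::field_char_0 \<Rightarrow> real"
    and \<iota> :: "'k \<Rightarrow> 'l::{field_char_0,polish_space}"
    and v :: "'l \<Rightarrow> real"
    and M :: "'l measure"
    and \<Lambda> :: "'k set" and p :: nat and L :: "nat \<Rightarrow> 'k set"
    and r :: "nat \<Rightarrow> 'k \<Rightarrow> 'k" and c :: "nat \<Rightarrow> 'k" and H :: "'k \<Rightarrow> 'k"
    and e :: "'l \<Rightarrow> complex" and h :: "nat \<Rightarrow> 'l \<Rightarrow> 'l"
    and X :: "(nat \<Rightarrow> nat) \<Rightarrow> 'l" and \<phi> :: "'l \<Rightarrow> complex" and T :: "('l \<Rightarrow> complex) \<Rightarrow> complex"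
  assumes "number_field TYPE('k)"
    and "hydra_map \<Lambda> p L r c H" and "proper_hydra r"
    and "absolute_value w" and "nontrivial_abs w"
    and "completion_at w \<iota> v"
    and "haar_measure v M"
    and "hydra_rho w p r < 1"
    and e_eq: "e = add_char v"
    and h_eq: "h = branch_ext \<iota> r c"
    and X_eq: "X = numen_ext p \<iota> r c"
    and phi_eq: "\<phi> = char_fun p e X"
    and T_eq: "T = wiener_functional e M \<phi>"
  shows "continuous_linear_on_wiener e M T \<and>
    (\<exists>\<mu>. borel_prob \<mu> \<and>
         (\<forall>f\<in>wiener_algebra e M. integrable \<mu> f \<and> (LINT z|\<mu>. f z) = T f) \<and>
         (\<forall>t. \<phi> t = (LINT z|\<mu>. e (- (t * z)))) \<and>
         self_similar p h \<mu> \<and>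
         (\<forall>f :: 'l \<Rightarrow> complex. integrable \<mu> f \<longrightarrow>
            (\<forall>j<p. integrable \<mu> (\<lambda>z. f (h j z))) \<and>
            (LINT z|\<mu>. f z) = (1 / of_nat p) * (\<Sum>j<p. LINT z|\<mu>. f (h j z))) \<and>
         (\<forall>\<nu>. borel_prob \<nu> \<and> self_similar p h \<nu> \<longrightarrow> \<nu> = \<mu>) \<and>
         (\<forall>f :: 'l \<Rightarrow> complex. integrable M f \<longrightarrow>
            (integrable \<mu> f \<longleftrightarrow> integrable (padic_haar p) (\<lambda>z. f (X z))) \<and>
            (LINT z|\<mu>. f z) = (LINT z|padic_haar p. f (X z))))"
proof -
  have p: "2 \<le> p"
    using assms(2) by (rule hydra_map_ge_2)
  have "\<forall>j<p. rat_linear (r j) \<and> bij (r j)"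
    using assms(2) unfolding hydra_map_def by blast
  then have lin: "rat_linear (r j)" and bij: "bij (r j)" if "j < p" for j
    using that by simp_all
  define R where "R j = enn2real (op_norm w (r j))" for j
  have pos: "0 < op_norm w (r j)" if "j < p" for j
    using op_norm_pos[OF assms(4) lin bij_is_inj[OF bij]] that by blast
  have fin: "op_norm w (r j) < \<infinity>" if "j < p" for j
    using ennreal_prod_less_1D(1)[OF _ assms(8)[unfolded hydra_rho_def]] pos that by simp
  have prod_R: "(\<Prod>j<p. R j) < 1"
    unfolding R_def using ennreal_prod_less_1D(2)[OF _ assms(8)[unfolded hydra_rho_def]] pos by simp
  have branch: "h j (\<iota> z) = \<iota> (r j z + c j)" "dist (h j x) (h j y) \<le> R j * dist x y"
    if "j < p" for j z x y
    unfolding h_eq R_def by (rule branch_ext[where r = r, OF assms(1,4-6) lin[OF that] fin[OF that]])+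
  interpret I: contractive_ifs p h R
  proof
    show "0 < R j" if "j < p" for j
      using pos[OF that] fin[OF that] by (simp add: R_def enn2real_positive_iff)
    show "dist (h j x) (h j y) \<le> R j * dist x y" if "j < p" for j x y
      by (rule branch(2)[OF that])
  qed (use p prod_R in auto)
  \<comment> \<open>This start point makes the finite iterates equal to values of the numen
    itself.\<close>
  define \<mu> where "\<mu> = I.stationary (\<iota> (numen p r c 0))"
  have X [measurable]: "X \<in> borel_measurable (padic_haar p)"
    unfolding X_eq padic_haar_def measurable_distr_eq1 by (rule measurable_numen_ext)
  have distr_X: "distr (padic_haar p) borel X = \<mu>"
    unfolding X_eq \<mu>_def by (rule I.distr_numen_ext[OF p assms(3) branch(1)])
  have \<mu>: "borel_prob \<mu>" unfolding \<mu>_def by (rule I.borel_prob_stationary)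

  interpret valued_metric_field v
    using assms(6) by unfold_locales (simp_all add: completion_at_def)
  obtain B :: "'l set" where "basis_over base_field B"
    using completion_exists_basis[OF assms(1,6)] by blast
  then have cont_e: "continuous_on UNIV e"
    unfolding e_eq by (rule continuous_on_add_char)
  then have e [measurable]: "e \<in> borel_measurable borel"
    by (rule borel_measurable_continuous_onI)
  have norm_e: "cmod (e x) = 1" for x
    by (simp add: e_eq)
  \<comment> \<open>By second countability the product of the Borel algebras is the Borel algebra of
    the product, so joint continuity of multiplication suffices.\<close>
  have mult: "(\<lambda>z :: 'l \<times> 'l. fst z * snd z) \<in> borel_measurable (borel \<Otimes>\<^sub>M borel)"
    unfolding borel_prod
    by (intro borel_measurable_continuous_onI continuous_on_times continuous_intros)
  have e_t [measurable]: "(\<lambda>z. e (- (t * z))) \<in> borel_measurable borel" for t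
    by (rule borel_measurable_continuous_onI, rule continuous_on_compose2[OF cont_e])
      (auto intro!: continuous_on_uminus continuous_on_times continuous_intros)
  have \<phi>: "\<phi> t = (LINT z|\<mu>. e (- (t * z)))" for t
    unfolding phi_eq char_fun_def distr_X[symmetric] by (rule integral_distr[symmetric]) measurable

  have M: "sigma_finite_measure M" "sets M = sets borel"
    using assms(7) haar_measure_sigma_finite by (auto simp: haar_measure_def)
  note rep = represents_integral[OF M \<mu> e norm_e mult represents_wiener_hat]
  \<comment> \<open>The argument \<open>- t\<close> in \<open>wiener_functional\<close> cancels the
    sign in \<open>\<phi>\<close>, leaving the inner integral of \<open>e (t * z)\<close> that
    Fubini's theorem produces.\<close>
  have T: "T f = (LINT z|\<mu>. f z)" if "f \<in> wiener_algebra e M" for f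
    unfolding T_eq wiener_functional_def rep(2)[OF that] \<phi> by simp
  have lin_T: "T (\<lambda>z. a * f z + b * g z) = a * T f + b * T g"
    if f: "f \<in> wiener_algebra e M" and g: "g \<in> wiener_algebra e M" for f g a b
    using T[OF wiener_algebra_lincomb[OF M(2) e norm_e mult f g]] rep(1)[OF f] rep(1)[OF g]
    by (simp add: T f g)
  have "cmod (T f) \<le> 1 * wiener_norm e M f" if "f \<in> wiener_algebra e M" for f
    using rep(3)[OF that] by (simp add: T[OF that] wiener_norm_def)
  then have cont_T: "continuous_linear_on_wiener e M T"
    unfolding continuous_linear_on_wiener_def using lin_T by blast
  have push: "(\<forall>j<p. integrable \<mu> (\<lambda>z. f (h j z))) \<and>
      (LINT z|\<mu>. f z) = (1 / of_nat p) * (\<Sum>j<p. LINT z|\<mu>. f (h j z))"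
    if "integrable \<mu> f" for f :: "'l \<Rightarrow> complex"
    using I.integral_stationary[OF that[unfolded \<mu>_def]]
    by (simp add: \<mu>_def scaleR_conv_of_real inverse_eq_divide)
  have law: "(integrable \<mu> f \<longleftrightarrow> integrable (padic_haar p) (\<lambda>z. f (X z))) \<and>
      (LINT z|\<mu>. f z) = (LINT z|padic_haar p. f (X z))"
    if "integrable M f" for f :: "'l \<Rightarrow> complex"
  proof -
    \<comment> \<open>Measurability carries over because \<open>M\<close> has the Borel sets as its
      measurable sets; the rest is change of variables. If \<open>f\<close> is not integrable for
      \<mu>, both integrals have the default value 0.\<close>
    have f: "f \<in> borel_measurable borel"
      using borel_measurable_integrable[OF that] measurable_cong_sets[OF M(2) refl] by blast
    show ?thesis
      unfolding distr_X[symmetric] using integrable_distr_eq[OF X f] integral_distr[OF X f] by blast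
  qed
  show ?thesis
  proof (rule conjI[OF cont_T], rule exI[of _ \<mu>], intro conjI ballI)
    show "\<forall>t. \<phi> t = (LINT z|\<mu>. e (- (t * z)))"
      using \<phi> by (rule allI)
    show "self_similar p h \<mu>"
      unfolding \<mu>_def by (rule I.self_similar_stationary)
    show "\<forall>f :: 'l \<Rightarrow> complex. integrable \<mu> f \<longrightarrow>
        (\<forall>j<p. integrable \<mu> (\<lambda>z. f (h j z))) \<and>
        (LINT z|\<mu>. f z) = (1 / of_nat p) * (\<Sum>j<p. LINT z|\<mu>. f (h j z))"
      by (intro allI impI push)
    show "\<forall>\<nu>. borel_prob \<nu> \<and> self_similar p h \<nu> \<longrightarrow> \<nu> = \<mu>"
      unfolding \<mu>_def using I.stationary_unique by blast
    show "\<forall>f :: 'l \<Rightarrow> complex. integrable M f \<longrightarrow>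
        (integrable \<mu> f \<longleftrightarrow> integrable (padic_haar p) (\<lambda>z. f (X z))) \<and>
        (LINT z|\<mu>. f z) = (LINT z|padic_haar p. f (X z))"
      by (intro allI impI law)
  qed (use \<mu> T rep(1) in simp_all)
qed

end
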